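(* Consider the online task assignment problem with controllable processing time described in the context, in the unlimited rejection case, i.e. $\Delta_u=\infty$ for every machine $u\in U$. Then the algorithm OMLA is $1/2$-competitive, i.e. $\mathbb{E}_{I}[\text{OMLA}(I)]\ge \tfrac12\,\mathbb{E}_{I}[\text{OPT}(I)]$ for every instance.
   Context: Problem. Let $G=(U,V;E)$ be a finite bipartite graph with machines $U$, task types $V$ and edges $E$; $E_u$ (resp. $E_v$) denotes the edges incident to $u$ (resp. $v$), and an edge is written $e=(u,v)$. There are $L$ processing levels $\mathcal{L}=\{1,\dots,L\}$. Processing task $v$ on machine $u$ at level $l$ gives reward $r_{u,v,l}$, with $r_{u,v,l}<r_{u,v,l'}$ whenever $l<l'$. The time horizon is $[T]=\{1,\dots,T\}$. Level $l$ has a random processing delay $d_l$, a positive integer drawn (independently each time) from a known distribution $D_l$, with $\mathbb{E}[d_l]<\mathbb{E}[d_{l'}]$ for $l<l'$. At each time $t$ at most one task arrives: type $v$ arrives with known probability $p_{v,t}$ ($\sum_v p_{v,t}\le 1$), independently across times. When $v$ arrives at $t$, the algorithm must immediately and irrevocably either discard it or assign it to an available machine $u$ with $(u,v)\in E$ together with a level $l$. Machine $u$ accepts with probability $q_e$ ($e=(u,v)$); on acceptance the reward $r_{u,v,l}$ is collected and $u$ is unavailable to other tasks until time $t+d_l$. On rejection no reward is collected and a penalty $\theta_l$ (a positive integer) is subtracted from $u$'s remaining budget $\delta_u$, initially $\Delta_u$ (a positive integer, or $\infty$); a machine with $\delta_u\le 0$ is permanently removed. Let $\theta=\max_l\theta_l$.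 An online algorithm decides at time $t$ knowing only arrivals up to $t$. Benchmark. For a realized arrival sequence $I$, $\text{OPT}(I)$ is the maximum expected total reward of an algorithm that knows $I$ in advance but learns acceptance/rejection outcomes (and delays) only when they occur. An algorithm ALG is $\alpha$-competitive if $\mathbb{E}_I[\text{ALG}(I)]\ge\alpha\,\mathbb{E}_I[\text{OPT}(I)]$ for every instance. LP. Let $\mathbf{x}^*=\{x^*_{e,l,t}\}$ be an optimal solution of the LP (Off): maximize $\sum_{t}\sum_{e\in E}q_e\sum_{l}r_{u,v,l}x_{e,l,t}$ subject to: (i) for all $u,t$: $\sum_{t'<t}\sum_{e\in E_u}q_e\sum_l x_{e,l,t'}\Pr\{d_l\ge t-t'+1\}+\sum_{e\in E_u}q_e\sum_l x_{e,l,t}\le 1$; (ii) for all $u$: $\sum_t\sum_{e\in E_u}\sum_l x_{e,l,t}[\theta q_e\Pr\{d_l>T-t\}+(1-q_e)\theta_l]\le\Delta_u+\theta-1$ (vacuous if $\Delta_u=\infty$); (iii) for all $v,t$: $0\le\sum_{e\in E_v}\sum_l x_{e,l,t}\le p_{v,t}$; (iv) for all $v,e\in E_v,t$: $0\le\sum_l x_{e,l,t}\le p_{v,t}$; (v) for all $u,t$: $0\le\sum_{e\in E_u}\sum_l x_{e,l,t}\le 1$. OMLA (unlimited case). Define for $u\in U$, $e=(u,v)\in E_u$, $l\in\mathcal{L}$, $t\in[T]$, backwards in $t$ with $R_{u,t}=0$ for $t>T$: $Q_{e,l,t}=q_e\big(r_{u,v,l}+\sum_{d'\in[T-t]}\Pr\{d_l=d'\}R_{u,t+d'}\big)+(1-q_e)R_{u,t+1}$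 and $R_{u,t}=\sum_{e\in E_u}\sum_l x^*_{e,l,t}\max\{Q_{e,l,t},R_{u,t+1}\}+(1-\sum_{e\in E_u}\sum_l x^*_{e,l,t})R_{u,t+1}$. OMLA: when $v$ arrives at $t$, pick the pair $(u,l)$ with $e=(u,v)\in E$ with probability $x^*_{e,l,t}/p_{v,t}$ (and no pair with the remaining probability); if a pair is picked, $u$ is available and $Q_{e,l,t}\ge R_{u,t+1}$, assign $v$ to $u$ at level $l$; otherwise discard $v$.
   Formalization: The LP variables x_{e,l,t} are required to be individually nonnegative; the displayed constraints bound only sums over levels, and without this the LP can be unbounded when L ≥ 2 and x*/p need not be a probability. *)

theory Defs
  imports "HOL-Probability.Probability" "HOL-Library.Extended_Nat"
begin

section \<open>Instances\<close>

record ('u, 'v) task_instance =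
  machines :: "'u set"
  task_types :: "'v set"
  edges :: "('u \<times> 'v) set"
  num_levels :: nat
  horizon :: nat
  reward :: "'u \<Rightarrow> 'v \<Rightarrow> nat \<Rightarrow> real"
  delay :: "nat \<Rightarrow> nat pmf"
  arrival_prob :: "'v \<Rightarrow> nat \<Rightarrow> real"
  accept_prob :: "'u \<times> 'v \<Rightarrow> real"
  penalty :: "nat \<Rightarrow> nat"
  budget :: "'u \<Rightarrow> enat"

definition levels :: "('u, 'v) task_instance \<Rightarrow> nat set" where
  "levels G = {1..num_levels G}"

definition times :: "('u, 'v) task_instance \<Rightarrow> nat set" where
  "times G = {1..horizon G}"

definition machine_edges :: "('u, 'v) task_instance \<Rightarrow> 'u \<Rightarrow> ('u \<times> 'v) set" where
  "machine_edges G u = {e \<in> edges G. fst e = u}"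

definition type_edges :: "('u, 'v) task_instance \<Rightarrow> 'v \<Rightarrow> ('u \<times> 'v) set" where
  "type_edges G v = {e \<in> edges G. snd e = v}"

text \<open>
  Mean delays are compared as extended nonnegative reals, so that the mean of a delay
  distribution is meaningful without an integrability assumption.
\<close>

definition valid_instance :: "('u, 'v) task_instance \<Rightarrow> bool" where
  "valid_instance G \<longleftrightarrow>
     finite (machines G) \<and> finite (task_types G) \<and>
     edges G \<subseteq> machines G \<times> task_types G \<and>
     1 \<le> num_levels G \<and>
     (\<forall>(u, v) \<in> edges G. \<forall>l \<in> levels G. \<forall>l' \<in> levels G.
        l < l' \<longrightarrow> reward G u v l < reward G u v l') \<and>
     (\<forall>l \<in> levels G. \<forall>d \<in> set_pmf (delay G l). 1 \<le> d) \<and>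
     (\<forall>l \<in> levels G. \<forall>l' \<in> levels G. l < l' \<longrightarrow>
        (\<integral>\<^sup>+ d. ennreal (real d) \<partial>measure_pmf (delay G l))
          < (\<integral>\<^sup>+ d. ennreal (real d) \<partial>measure_pmf (delay G l'))) \<and>
     (\<forall>v \<in> task_types G. \<forall>t \<in> times G. 0 \<le> arrival_prob G v t) \<and>
     (\<forall>t \<in> times G. (\<Sum>v\<in>task_types G. arrival_prob G v t) \<le> 1) \<and>
     (\<forall>e \<in> edges G. 0 \<le> accept_prob G e \<and> accept_prob G e \<le> 1) \<and>
     (\<forall>l \<in> levels G. 1 \<le> penalty G l) \<and>
     (\<forall>u \<in> machines G. 1 \<le> budget G u)"

section \<open>Arrivals\<close>

text \<open>
  The distribution giving \<open>Some a\<close> probability \<open>f a\<close> for \<open>a \<in> S\<close> and \<open>None\<close> the remaining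
  probability; \<open>embed_pmf\<close> is only meaningful under the hypotheses of \<open>pmf_sub_pmf\<close> below.
\<close>

definition sub_pmf :: "'a set \<Rightarrow> ('a \<Rightarrow> real) \<Rightarrow> 'a option pmf" where
  "sub_pmf S f = embed_pmf (\<lambda>z. case z of
      None \<Rightarrow> 1 - (\<Sum>a\<in>S. f a)
    | Some a \<Rightarrow> if a \<in> S then f a else 0)"

lemma pmf_sub_pmf:
  assumes "finite S" "\<And>a. a \<in> S \<Longrightarrow> 0 \<le> f a" "(\<Sum>a\<in>S. f a) \<le> 1"
  shows "pmf (sub_pmf S f) z = (case z of
      None \<Rightarrow> 1 - (\<Sum>a\<in>S. f a)
    | Some a \<Rightarrow> if a \<in> S then f a else 0)"
  unfolding sub_pmf_def
proof (rule pmf_embed_pmf)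
  let ?g = "\<lambda>z. case z of None \<Rightarrow> 1 - (\<Sum>a\<in>S. f a) | Some a \<Rightarrow> if a \<in> S then f a else 0"
  show "0 \<le> ?g z" for z
    using assms by (auto split: option.splits)
  have "(\<integral>\<^sup>+ z. ennreal (?g z) \<partial>count_space UNIV)
      = (\<Sum>z\<in>insert None (Some ` S). ennreal (?g z))"
    by (rule nn_integral_count_space')
      (use assms(1) in \<open>auto split: option.splits if_splits\<close>)
  also have "\<dots> = ennreal (\<Sum>z\<in>insert None (Some ` S). ?g z)"
    by (rule sum_ennreal) (use assms in \<open>auto split: option.splits\<close>)
  also have "(\<Sum>z\<in>insert None (Some ` S). ?g z) = 1"
    using assms(1) by (simp add: sum.reindex image_iff)
  finally show "(\<integral>\<^sup>+ z. ennreal (?g z) \<partial>count_space UNIV) = 1"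
    by simp
qed

definition arrivals :: "('u, 'v) task_instance \<Rightarrow> (nat \<Rightarrow> 'v option) pmf" where
  "arrivals G = Pi_pmf (times G) None
     (\<lambda>t. sub_pmf (task_types G) (\<lambda>v. arrival_prob G v t))"

section \<open>Policies and their rewards\<close>

text \<open>
  A log lists the assignments made so far as tuples (time, machine, task type, level, result).
  In the actual log the result is an \<open>outcome\<close>, which contains the realized delay. A policy only
  sees the observed log, in which the delay is hidden as long as the task is being processed.
\<close>

datatype outcome = Rejected | Accepted nat

datatype feedback = Refused | Running | Finished nat

type_synonym ('u, 'v) log = "(nat \<times> 'u \<times> 'v \<times> nat \<times> outcome) list"
type_synonym ('u, 'v) obs = "(nat \<times> 'u \<times> 'v \<times> nat \<times> feedback) list"

type_synonym 'u action = "('u \<times> nat) option"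
type_synonym ('u, 'v) policy = "nat \<Rightarrow> ('u, 'v) obs \<Rightarrow> 'u action pmf"

definition feedback_at :: "nat \<Rightarrow> nat \<Rightarrow> outcome \<Rightarrow> feedback" where
  "feedback_at t s z = (case z of
      Rejected \<Rightarrow> Refused
    | Accepted d \<Rightarrow> if s + d \<le> t then Finished d else Running)"

definition observe :: "nat \<Rightarrow> ('u, 'v) log \<Rightarrow> ('u, 'v) obs" where
  "observe t h = map (\<lambda>(s, u, v, l, z). (s, u, v, l, feedback_at t s z)) h"

definition total_penalty :: "('u, 'v) task_instance \<Rightarrow> ('u, 'v) obs \<Rightarrow> 'u \<Rightarrow> nat" where
  "total_penalty G h u =
     (\<Sum>(s, u', v, l, z)\<leftarrow>h. if u' = u \<and> z = Refused then penalty G l else 0)"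

text \<open>
  The remaining budget of \<open>u\<close> is \<open>budget G u\<close> minus \<open>total_penalty G h u\<close>; the machine is removed
  once this is not positive.
\<close>

definition available :: "('u, 'v) task_instance \<Rightarrow> ('u, 'v) obs \<Rightarrow> 'u \<Rightarrow> bool" where
  "available G h u \<longleftrightarrow>
     enat (total_penalty G h u) < budget G u \<and>
     \<not> (\<exists>s v l. (s, u, v, l, Running) \<in> set h)"

definition legal_actions ::
  "('u, 'v) task_instance \<Rightarrow> (nat \<Rightarrow> 'v option) \<Rightarrow> nat \<Rightarrow> ('u, 'v) obs \<Rightarrow> 'u action set" where
  "legal_actions G I t h = insert None
     {Some (u, l) | u l. \<exists>v. I t = Some v \<and> (u, v) \<in> edges G \<and> l \<in> levels G \<and> available G h u}"

definition admissible ::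
  "('u, 'v) task_instance \<Rightarrow> (nat \<Rightarrow> 'v option) \<Rightarrow> ('u, 'v) policy \<Rightarrow> bool" where
  "admissible G I \<pi> \<longleftrightarrow> (\<forall>t \<in> times G. \<forall>h. set_pmf (\<pi> t h) \<subseteq> legal_actions G I t h)"

definition step ::
  "('u, 'v) task_instance \<Rightarrow> (nat \<Rightarrow> 'v option) \<Rightarrow> ('u, 'v) policy \<Rightarrow> nat \<Rightarrow>
   ('u, 'v) log \<Rightarrow> ('u, 'v) log pmf" where
  "step G I \<pi> t h = bind_pmf (\<pi> t (observe t h)) (\<lambda>a. case (a, I t) of
      (Some (u, l), Some v) \<Rightarrow>
        bind_pmf (bernoulli_pmf (accept_prob G (u, v))) (\<lambda>b.
          if b then map_pmf (\<lambda>d. h @ [(t, u, v, l, Accepted d)]) (delay G l)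
          else return_pmf (h @ [(t, u, v, l, Rejected)]))
    | _ \<Rightarrow> return_pmf h)"

primrec run ::
  "('u, 'v) task_instance \<Rightarrow> (nat \<Rightarrow> 'v option) \<Rightarrow> ('u, 'v) policy \<Rightarrow> nat \<Rightarrow> ('u, 'v) log pmf" where
  "run G I \<pi> 0 = return_pmf []"
| "run G I \<pi> (Suc t) = bind_pmf (run G I \<pi> t) (step G I \<pi> (Suc t))"

definition total_reward :: "('u, 'v) task_instance \<Rightarrow> ('u, 'v) log \<Rightarrow> real" where
  "total_reward G h =
     (\<Sum>(s, u, v, l, z)\<leftarrow>h. case z of Rejected \<Rightarrow> 0 | Accepted d \<Rightarrow> reward G u v l)"

definition policy_value ::
  "('u, 'v) task_instance \<Rightarrow> (nat \<Rightarrow> 'v option) \<Rightarrow> ('u, 'v) policy \<Rightarrow> real" where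
  "policy_value G I \<pi> = measure_pmf.expectation (run G I \<pi> (horizon G)) (total_reward G)"

text \<open>
  The benchmark ranges over randomized policies that may depend on the whole arrival
  sequence \<open>I\<close>, but on outcomes and delays only through the observed log. For valid instances
  the set of values is nonempty and bounded, since an admissible policy makes at most one
  assignment, along an edge, per time step.
\<close>

definition OPT :: "('u, 'v) task_instance \<Rightarrow> (nat \<Rightarrow> 'v option) \<Rightarrow> real" where
  "OPT G I = (SUP \<pi> \<in> {\<pi>. admissible G I \<pi>}. policy_value G I \<pi>)"

text \<open>
  An algorithm assigns a policy to every arrival sequence; it is online if its decision at
  time \<open>t\<close> depends on the arrivals up to \<open>t\<close> only.
\<close>

type_synonym ('u, 'v) algorithm = "(nat \<Rightarrow> 'v option) \<Rightarrow> ('u, 'v) policy"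

definition online_algorithm :: "('u, 'v) task_instance \<Rightarrow> ('u, 'v) algorithm \<Rightarrow> bool" where
  "online_algorithm G A \<longleftrightarrow>
     (\<forall>I. admissible G I (A I)) \<and>
     (\<forall>I J t. (\<forall>s \<in> {1..t}. I s = J s) \<longrightarrow> t \<in> times G \<longrightarrow> A I t = A J t)"

section \<open>The linear program\<close>

type_synonym ('u, 'v) lp_var = "'u \<times> 'v \<Rightarrow> nat \<Rightarrow> nat \<Rightarrow> real"

definition max_penalty :: "('u, 'v) task_instance \<Rightarrow> nat" where
  "max_penalty G = Max (penalty G ` levels G)"

definition lp_objective :: "('u, 'v) task_instance \<Rightarrow> ('u, 'v) lp_var \<Rightarrow> real" where
  "lp_objective G x =
     (\<Sum>t\<in>times G. \<Sum>(u, v)\<in>edges G. accept_prob G (u, v) *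
        (\<Sum>l\<in>levels G. reward G u v l * x (u, v) l t))"

text \<open>
  The variables are nonnegative; the lower bounds on sums of variables in the program do not
  by themselves make \<open>x e l t / arrival_prob G v t\<close> a probability.
\<close>

definition lp_feasible :: "('u, 'v) task_instance \<Rightarrow> ('u, 'v) lp_var \<Rightarrow> bool" where
  "lp_feasible G x \<longleftrightarrow>
     (\<forall>e \<in> edges G. \<forall>l \<in> levels G. \<forall>t \<in> times G. 0 \<le> x e l t) \<and>
     (\<forall>u \<in> machines G. \<forall>t \<in> times G.
        (\<Sum>t'\<in>{1..<t}. \<Sum>e\<in>machine_edges G u. accept_prob G e *
           (\<Sum>l\<in>levels G. x e l t' * measure_pmf.prob (delay G l) {t - t' + 1..}))
        + (\<Sum>e\<in>machine_edges G u. accept_prob G e * (\<Sum>l\<in>levels G. x e l t)) \<le> 1) \<and>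
     (\<forall>u \<in> machines G. \<forall>b. budget G u = enat b \<longrightarrow>
        (\<Sum>t\<in>times G. \<Sum>e\<in>machine_edges G u. \<Sum>l\<in>levels G. x e l t *
           (real (max_penalty G) * accept_prob G e *
              measure_pmf.prob (delay G l) {horizon G - t<..}
            + (1 - accept_prob G e) * real (penalty G l)))
        \<le> real b + real (max_penalty G) - 1) \<and>
     (\<forall>v \<in> task_types G. \<forall>t \<in> times G.
        0 \<le> (\<Sum>e\<in>type_edges G v. \<Sum>l\<in>levels G. x e l t) \<and>
        (\<Sum>e\<in>type_edges G v. \<Sum>l\<in>levels G. x e l t) \<le> arrival_prob G v t) \<and>
     (\<forall>v \<in> task_types G. \<forall>e \<in> type_edges G v. \<forall>t \<in> times G.
        0 \<le> (\<Sum>l\<in>levels G. x e l t) \<and> (\<Sum>l\<in>levels G. x e l t) \<le> arrival_prob G v t) \<and>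
     (\<forall>u \<in> machines G. \<forall>t \<in> times G.
        0 \<le> (\<Sum>e\<in>machine_edges G u. \<Sum>l\<in>levels G. x e l t) \<and>
        (\<Sum>e\<in>machine_edges G u. \<Sum>l\<in>levels G. x e l t) \<le> 1)"

definition lp_optimal :: "('u, 'v) task_instance \<Rightarrow> ('u, 'v) lp_var \<Rightarrow> bool" where
  "lp_optimal G x \<longleftrightarrow>
     lp_feasible G x \<and> (\<forall>y. lp_feasible G y \<longrightarrow> lp_objective G y \<le> lp_objective G x)"

section \<open>The algorithm\<close>

function (sequential)
  R_value :: "('u, 'v) task_instance \<Rightarrow> ('u, 'v) lp_var \<Rightarrow> 'u \<Rightarrow> nat \<Rightarrow> real" and
  Q_value :: "('u, 'v) task_instance \<Rightarrow> ('u, 'v) lp_var \<Rightarrow> 'u \<times> 'v \<Rightarrow> nat \<Rightarrow> nat \<Rightarrow> real" where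
  "R_value G x u t = (if t > horizon G then 0 else
     (\<Sum>e\<in>machine_edges G u. \<Sum>l\<in>levels G.
        x e l t * max (Q_value G x e l t) (R_value G x u (t + 1)))
     + (1 - (\<Sum>e\<in>machine_edges G u. \<Sum>l\<in>levels G. x e l t)) * R_value G x u (t + 1))"
| "Q_value G x (u, v) l t =
     accept_prob G (u, v) *
       (reward G u v l
        + (\<Sum>d\<in>{1..horizon G - t}. pmf (delay G l) d * R_value G x u (t + d)))
     + (1 - accept_prob G (u, v)) * R_value G x u (t + 1)"
  by pat_completeness auto
termination
  by (relation "Wellfounded.measure (\<lambda>z. case z of
      Inl (G, x, u, t) \<Rightarrow> 2 * (horizon G + 1 - t)
    | Inr (G, x, e, l, t) \<Rightarrow> if t > horizon G then 1 else 2 * (horizon G + 1 - t) - 1)") auto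

declare R_value.simps [simp del] Q_value.simps [simp del]

text \<open>If \<open>arrival_prob G v t = 0\<close>, the quotients are \<open>0\<close> and no pair is picked.\<close>

definition pick ::
  "('u, 'v) task_instance \<Rightarrow> ('u, 'v) lp_var \<Rightarrow> nat \<Rightarrow> 'v \<Rightarrow> ('u \<times> nat) option pmf" where
  "pick G x t v = sub_pmf {(u, l). (u, v) \<in> edges G \<and> l \<in> levels G}
     (\<lambda>(u, l). x (u, v) l t / arrival_prob G v t)"

definition OMLA :: "('u, 'v) task_instance \<Rightarrow> ('u, 'v) lp_var \<Rightarrow> ('u, 'v) algorithm" where
  "OMLA G x I t h = (case I t of
      None \<Rightarrow> return_pmf None
    | Some v \<Rightarrow> map_pmf
        (\<lambda>a. case a of
            None \<Rightarrow> None
          | Some (u, l) \<Rightarrow>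
              if available G h u \<and> Q_value G x (u, v) l t \<ge> R_value G x u (t + 1)
              then Some (u, l) else None)
        (pick G x t v))"

lemma OMLA_online_algorithm:
  assumes G: "valid_instance G" and x: "lp_feasible G x"
  shows "online_algorithm G (OMLA G x)"
  unfolding online_algorithm_def
proof (intro conjI allI impI)
  fix I J :: "nat \<Rightarrow> 'b option" and t
  assume "\<forall>s\<in>{1..t}. I s = J s" "t \<in> times G"
  then have "I t = J t" by (simp add: times_def)
  then show "OMLA G x I t = OMLA G x J t" by (simp add: OMLA_def fun_eq_iff)
next
  fix I :: "nat \<Rightarrow> 'b option"
  have pick: "(u, v) \<in> edges G \<and> l \<in> levels G"
    if t: "t \<in> times G" and ul: "Some (u, l) \<in> set_pmf (pick G x t v)" for t u v l
  proof -
    let ?S = "{(u, l). (u, v) \<in> edges G \<and> l \<in> levels G}"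
    let ?f = "\<lambda>(u, l). x (u, v) l t / arrival_prob G v t"
    have fin: "finite (edges G)"
      using G by (auto simp: valid_instance_def intro: finite_subset)
    have S: "?S = fst ` type_edges G v \<times> levels G"
      by (force simp: type_edges_def)
    have finS: "finite ?S"
      unfolding S using fin by (simp add: type_edges_def levels_def)
    have sum: "(\<Sum>a\<in>?S. ?f a)
        = (\<Sum>e\<in>type_edges G v. \<Sum>l\<in>levels G. x e l t) / arrival_prob G v t"
    proof -
      have inj: "inj_on fst (type_edges G v)"
        by (auto simp: inj_on_def type_edges_def)
      have "(\<Sum>a\<in>?S. ?f a) = (\<Sum>u\<in>fst ` type_edges G v. \<Sum>l\<in>levels G. ?f (u, l))"
        unfolding S sum.cartesian_product by simp
      also have "\<dots> = (\<Sum>e\<in>type_edges G v. \<Sum>l\<in>levels G. ?f (fst e, l))"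
        using inj by (simp add: sum.reindex)
      also have "\<dots> = (\<Sum>e\<in>type_edges G v. \<Sum>l\<in>levels G. x e l t / arrival_prob G v t)"
        by (intro sum.cong) (auto simp: type_edges_def)
      finally show ?thesis by (simp add: sum_divide_distrib)
    qed
    have V: "v \<in> task_types G" if "(u, v) \<in> edges G" for u
      using that G by (auto simp: valid_instance_def)
    have nonneg: "0 \<le> ?f a" if "a \<in> ?S" for a
    proof -
      obtain u l where "a = (u, l)" "(u, v) \<in> edges G" "l \<in> levels G" using \<open>a \<in> ?S\<close> by blast
      moreover from this have "0 \<le> x (u, v) l t" using x t by (auto simp: lp_feasible_def)
      moreover have "0 \<le> arrival_prob G v t"
        using V calculation(2) G t by (auto simp: valid_instance_def)
      ultimately show ?thesis by simp
    qed
    have le1: "(\<Sum>a\<in>?S. ?f a) \<le> 1"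
    proof (cases "v \<in> task_types G")
      case True
      then have "(\<Sum>e\<in>type_edges G v. \<Sum>l\<in>levels G. x e l t) \<le> arrival_prob G v t"
        using x t by (simp add: lp_feasible_def)
      moreover have "0 \<le> arrival_prob G v t" using True G t by (simp add: valid_instance_def)
      ultimately show ?thesis unfolding sum by (auto simp: divide_le_eq_1)
    next
      case False
      then have "?S = {}" using V by blast
      then show ?thesis by (simp only: sum.empty)
    qed
    have "pmf (pick G x t v) (Some (u, l)) \<noteq> 0" using ul by (simp add: set_pmf_iff)
    moreover have "pmf (pick G x t v) (Some (u, l)) = (if (u, l) \<in> ?S then ?f (u, l) else 0)"
      unfolding pick_def by (subst pmf_sub_pmf[OF finS nonneg le1]) simp_all
    ultimately have "(u, l) \<in> ?S" by presburger
    then show ?thesis by simp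
  qed
  show "admissible G I (OMLA G x I)"
    unfolding admissible_def
  proof (intro ballI allI subsetI)
    fix t h a assume t: "t \<in> times G" and a: "a \<in> set_pmf (OMLA G x I t h)"
    show "a \<in> legal_actions G I t h"
      using a pick[OF t]
      by (force simp: OMLA_def legal_actions_def split: option.splits if_splits)
  qed
qed

end

theory Submission
  imports Defs
begin

text \<open>
  By linearity, averaging the assignment probabilities of any clairvoyant policies over the
  arrivals gives a feasible point of the linear program, so its optimum bounds the benchmark.
  For OMLA, the collected reward plus the sum over the machines of the value-to-go \<open>R_value\<close>
  at the time when the machine is next free is a martingale, so its expected reward is
  \<open>\<Sum>u. R_value G x u 1\<close>. Finally, for each machine, an accepted task loses the decrease of
  \<open>R_value\<close> over the time it occupies the machine. By the capacity constraint these
  losses sum to at most the total decrease \<open>R_value G x u 1\<close>, while \<open>R_value G x u 1\<close> plus the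
  losses is at least the contribution of the machine to the linear program.
\<close>

section \<open>Expectations over probability mass functions\<close>

text \<open>The factor 1/2 arises because \<open>R_value G x u 1\<close> is spent twice: once on the
  gains net of losses, once on the losses. Machines can be treated separately although a task goes
  to only one of them: OMLA picks its pair before looking at availability, so, averaged over the
  arrival, the pair is picked with probability \<open>x e l t\<close> in every state of the
  machines. With infinite budgets the state of a machine is just its release time, so a value-to-go
  with a single time argument suffices. Clairvoyance cannot beat the program because acceptance and
  delay are drawn independently of the choice, which makes the capacity bound hold for each fixed
  arrival sequence. The analytic obstacle is that delays may have unbounded support and arbitrary
  logs have unbounded reward, so exchanges of expectations over logs and outcomes rest on bounds
  valid only on the support.\<close>

lemma integrable_measure_pmf_bounded:
  fixes f :: "'a \<Rightarrow> real"
  assumes "\<And>x. x \<in> set_pmf p \<Longrightarrow> \<bar>f x\<bar> \<le> B"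
  shows "integrable (measure_pmf p) f"
  by (rule measure_pmf.integrable_const_bound[where B = B]) (use assms in \<open>auto simp: AE_measure_pmf_iff\<close>)

lemma abs_expectation_le:
  fixes f :: "'a \<Rightarrow> real"
  assumes "\<And>x. x \<in> set_pmf p \<Longrightarrow> \<bar>f x\<bar> \<le> B"
  shows "\<bar>measure_pmf.expectation p f\<bar> \<le> B"
proof -
  have "- B \<le> measure_pmf.expectation p f"
    using integrable_measure_pmf_bounded[of p f B] assms
    by (intro measure_pmf.integral_ge_const) (force simp: AE_measure_pmf_iff abs_le_iff)+
  moreover have "measure_pmf.expectation p f \<le> B"
    using integrable_measure_pmf_bounded[of p f B] assms
    by (intro measure_pmf.integral_le_const) (force simp: AE_measure_pmf_iff abs_le_iff)+
  ultimately show ?thesis by linarith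
qed

lemma integral_cong_pmf:
  assumes "\<And>x. x \<in> set_pmf p \<Longrightarrow> f x = g x"
  shows "measure_pmf.expectation p f = measure_pmf.expectation p g"
  by (rule integral_cong_AE) (use assms in \<open>auto simp: AE_measure_pmf_iff\<close>)

text \<open>Truncating \<open>f\<close> at the bound gives an everywhere bounded function that
  agrees with \<open>f\<close> on the support of the compound distribution; the exchange of
  integrals is done for the truncation and carried back. Using \<open>\<bar>B\<bar>\<close> keeps
  the truncation interval nonempty without an argument about the sign of \<open>B\<close>.\<close>

lemma integral_bind_pmf_bounded:
  fixes f :: "'b \<Rightarrow> real"
  assumes B: "\<And>y. y \<in> set_pmf (bind_pmf p k) \<Longrightarrow> \<bar>f y\<bar> \<le> B"
  shows "measure_pmf.expectation (bind_pmf p k) f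
    = measure_pmf.expectation p (\<lambda>x. measure_pmf.expectation (k x) f)"
proof -
  define g where "g y = max (- \<bar>B\<bar>) (min \<bar>B\<bar> (f y))" for y
  have g: "f y = g y" if "y \<in> set_pmf (bind_pmf p k)" for y
    using B[OF that] by (auto simp: g_def)
  have "measure_pmf.expectation (bind_pmf p k) f = measure_pmf.expectation (bind_pmf p k) g"
    by (rule integral_cong_pmf) (rule g)
  also have "\<dots> = measure_pmf.expectation p (\<lambda>x. measure_pmf.expectation (k x) g)"
    unfolding measure_pmf_bind
    by (rule integral_bind[where K = "count_space UNIV" and B' = 1 and B = "\<bar>B\<bar>"])
      (auto simp: g_def space_subprob_algebra intro!: subprob_space_measure_pmf measurable_measure_pmf)
  also have "\<dots> = measure_pmf.expectation p (\<lambda>x. measure_pmf.expectation (k x) f)"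
    by (intro integral_cong_pmf) (auto intro!: g[symmetric])
  finally show ?thesis .
qed

text \<open>The mass of \<open>None\<close> is eliminated as the complement, so that
  \<open>F None\<close> becomes a baseline and only differences to it remain. This is the form
  needed later, where \<open>None\<close> means discarding the task.\<close>

lemma expectation_option_pmf:
  fixes F :: "'a option \<Rightarrow> real"
  assumes "finite S" "set_pmf p \<subseteq> insert None (Some ` S)"
  shows "measure_pmf.expectation p F
    = F None + (\<Sum>a\<in>S. pmf p (Some a) * (F (Some a) - F None))"
proof -
  have "(\<Sum>z\<in>insert None (Some ` S). pmf p z) = 1"
    by (rule sum_pmf_eq_1) (use assms in auto)
  then have None: "pmf p None = 1 - (\<Sum>a\<in>S. pmf p (Some a))"
    using assms(1) by (simp add: sum.reindex image_iff)
  have "measure_pmf.expectation p F = (\<Sum>z\<in>insert None (Some ` S). F z * pmf p z)"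
    by (rule integral_measure_pmf_real) (use assms in auto)
  also have "\<dots> = F None * pmf p None + (\<Sum>a\<in>S. F (Some a) * pmf p (Some a))"
    using assms(1) by (simp add: sum.reindex image_iff)
  finally show ?thesis
    by (simp add: None algebra_simps sum_subtractf sum_distrib_left)
qed

section \<open>Lower bound on the value-to-go\<close>

text \<open>Summation by parts. If \<open>p\<close> is a distribution on the positive integers, the
  second factor is the tail probability of exceeding \<open>j\<close>, and both sides equal the mean
  of \<open>f 1 - f (min d (N + 1))\<close>.\<close>

lemma telescoping_tail_sum:
  fixes f p :: "nat \<Rightarrow> real"
  shows "(\<Sum>j\<in>{1..N}. (f j - f (j + 1)) * (1 - (\<Sum>d\<in>{1..j}. p d)))
    = f 1 - f (N + 1) * (1 - (\<Sum>d\<in>{1..N}. p d)) - (\<Sum>d\<in>{1..N}. p d * f d)"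
  by (induction N) (simp_all add: algebra_simps)

lemma prob_atLeast_eq:
  fixes D :: "nat pmf"
  assumes "0 \<notin> set_pmf D"
  shows "measure_pmf.prob D {j + 1..} = 1 - (\<Sum>d\<in>{1..j}. pmf D d)"
proof -
  have "{j + 1..} = - {..j}" by auto
  then have "measure_pmf.prob D {j + 1..} = 1 - measure_pmf.prob D {..j}"
    by (simp add: measure_pmf.prob_compl[symmetric] Compl_eq_Diff_UNIV)
  also have "measure_pmf.prob D {..j} = (\<Sum>d\<in>{..j}. pmf D d)"
    by (simp add: measure_measure_pmf_finite)
  also have "\<dots> = (\<Sum>d\<in>{1..j}. pmf D d)"
    by (rule sum.mono_neutral_right) (use assms in \<open>auto simp: set_pmf_iff not_le\<close>)
  finally show ?thesis .
qed

text \<open>The comparison for one machine, stripped of the instance: an index \<open>k\<close> is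
  an edge with a level, and \<open>y k t\<close> is the mass of accepted assignments. The loss of a
  task started at \<open>t\<close> is spread over the steps \<open>s\<close> at which it still
  blocks the machine, each costing \<open>R s - R (s + 1)\<close>. After exchanging the sums, the
  decrease at \<open>s\<close> is weighted by the mass of tasks running at \<open>s\<close>, which
  \<open>busy\<close> bounds by 1.\<close>

lemma value_to_go_lower_bound:
  fixes R :: "nat \<Rightarrow> real" and y :: "'k \<Rightarrow> nat \<Rightarrow> real" and D :: "'k \<Rightarrow> nat pmf"
  assumes D: "\<And>k. k \<in> K \<Longrightarrow> 0 \<notin> set_pmf (D k)"
    and y: "\<And>k t. k \<in> K \<Longrightarrow> t \<in> {1..T} \<Longrightarrow> 0 \<le> y k t"
    and end0: "R (T + 1) = 0"
    and mono: "\<And>t. t \<in> {1..T} \<Longrightarrow> R (t + 1) \<le> R t"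
    and rec: "\<And>t. t \<in> {1..T} \<Longrightarrow>
      (\<Sum>k\<in>K. y k t * (r k + (\<Sum>d\<in>{1..T - t}. pmf (D k) d * R (t + d)) - R (t + 1)))
        \<le> R t - R (t + 1)"
    and busy: "\<And>s. s \<in> {1..T} \<Longrightarrow>
      (\<Sum>t\<in>{1..<s}. \<Sum>k\<in>K. y k t * measure_pmf.prob (D k) {s - t + 1..}) + (\<Sum>k\<in>K. y k s) \<le> 1"
  shows "(\<Sum>t\<in>{1..T}. \<Sum>k\<in>K. y k t * r k) \<le> 2 * R 1"
proof -
  \<comment> \<open>This is the expected change of the continuation value on acceptance, hence minus
    the loss. Truncating the sum at \<open>T - t\<close> is harmless because such later values
    vanish in the application.\<close>
  define c where "c k t = (\<Sum>d\<in>{1..T - t}. pmf (D k) d * R (t + d)) - R (t + 1)" for k t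
  have loss: "c k t = - (\<Sum>s\<in>{t + 1..T}. (R s - R (s + 1)) * measure_pmf.prob (D k) {s - t + 1..})"
    if "k \<in> K" "t \<in> {1..T}" for k t
  proof -
    have "(\<Sum>s\<in>{t + 1..T}. (R s - R (s + 1)) * measure_pmf.prob (D k) {s - t + 1..})
      = (\<Sum>j\<in>{1..T - t}. (R (t + j) - R (t + (j + 1))) * measure_pmf.prob (D k) {j + 1..})"
      by (rule sum.reindex_bij_witness[of _ "\<lambda>j. t + j" "\<lambda>s. s - t"]) (use that in auto)
    also have "\<dots> = - c k t"
      \<comment> \<open>With \<open>N = T - t\<close>, the boundary term of the telescoped sum is
        \<open>R (T + 1) = 0\<close>.\<close>
      unfolding prob_atLeast_eq[OF D[OF that(1)]]
      by (subst telescoping_tail_sum[where f = "\<lambda>j. R (t + j)"]) (use that end0 in \<open>simp add: c_def\<close>)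
    finally show ?thesis by simp
  qed
  have "(\<Sum>t\<in>{1..T}. \<Sum>k\<in>K. y k t * r k) + (\<Sum>t\<in>{1..T}. \<Sum>k\<in>K. y k t * c k t)
      = (\<Sum>t\<in>{1..T}. \<Sum>k\<in>K. y k t * (r k + (\<Sum>d\<in>{1..T - t}. pmf (D k) d * R (t + d)) - R (t + 1)))"
    by (simp add: c_def sum.distrib[symmetric] algebra_simps)
  also have "\<dots> \<le> (\<Sum>t\<in>{1..T}. R t - R (t + 1))"
    by (intro sum_mono rec)
  also have "\<dots> = R 1"
    using sum_Suc_diff[of 1 T "\<lambda>t. - R t"] end0 by simp
  finally have gain: "(\<Sum>t\<in>{1..T}. \<Sum>k\<in>K. y k t * r k) \<le> R 1 - (\<Sum>t\<in>{1..T}. \<Sum>k\<in>K. y k t * c k t)"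
    by simp
  have "- (\<Sum>t\<in>{1..T}. \<Sum>k\<in>K. y k t * c k t)
      = (\<Sum>t\<in>{1..T}. \<Sum>s\<in>{t + 1..T}. \<Sum>k\<in>K.
           (R s - R (s + 1)) * (y k t * measure_pmf.prob (D k) {s - t + 1..}))"
    by (simp add: loss sum_negf sum_distrib_left sum.swap[of _ K] algebra_simps)
  also have "\<dots> = (\<Sum>s\<in>{1..T}. \<Sum>t\<in>{1..<s}. \<Sum>k\<in>K.
           (R s - R (s + 1)) * (y k t * measure_pmf.prob (D k) {s - t + 1..}))"
    unfolding sum.Sigma[OF finite_atLeastAtMost ballI[OF finite_atLeastAtMost]]
       sum.Sigma[OF finite_atLeastAtMost ballI[OF finite_atLeastLessThan]]
    by (rule sum.reindex_bij_witness[of _ prod.swap prod.swap]) auto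
  also have "\<dots> = (\<Sum>s\<in>{1..T}. (R s - R (s + 1)) *
      (\<Sum>t\<in>{1..<s}. \<Sum>k\<in>K. y k t * measure_pmf.prob (D k) {s - t + 1..}))"
    by (simp add: sum_distrib_left)
  also have "\<dots> \<le> (\<Sum>s\<in>{1..T}. (R s - R (s + 1)) * 1)"
  proof (intro sum_mono mult_left_mono)
    fix s assume s: "s \<in> {1..T}"
    then show "0 \<le> R s - R (s + 1)" using mono[of s] by simp
    \<comment> \<open>\<open>busy\<close> also counts tasks started at \<open>s\<close> itself;
      these cause no loss at \<open>s\<close>, so their nonnegative mass is dropped.\<close>
    have "0 \<le> (\<Sum>k\<in>K. y k s)" by (intro sum_nonneg y s)
    then show "(\<Sum>t\<in>{1..<s}. \<Sum>k\<in>K. y k t * measure_pmf.prob (D k) {s - t + 1..}) \<le> 1"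
      using busy[OF s] by linarith
  qed
  also have "\<dots> = R 1"
    using sum_Suc_diff[of 1 T "\<lambda>t. - R t"] end0 by simp
  finally show ?thesis using gain by simp
qed

section \<open>Logs and assignment probabilities\<close>

text \<open>Isolated from \<open>step\<close> because this law depends on the edge and the level
  alone, not on the log or the arrivals. That independence makes expected rewards and occupation
  times linear in the assignment probabilities.\<close>

definition outcome_pmf :: "('u, 'v) task_instance \<Rightarrow> 'u \<times> 'v \<Rightarrow> nat \<Rightarrow> outcome pmf" where
  "outcome_pmf G e l = bind_pmf (bernoulli_pmf (accept_prob G e))
     (\<lambda>b. if b then map_pmf Accepted (delay G l) else return_pmf Rejected)"

lemma step_eq:
  "step G I \<pi> t h = bind_pmf (\<pi> t (observe t h)) (\<lambda>a. case (a, I t) of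
      (Some (u, l), Some v) \<Rightarrow> map_pmf (\<lambda>z. h @ [(t, u, v, l, z)]) (outcome_pmf G (u, v) l)
    | _ \<Rightarrow> return_pmf h)"
  unfolding step_def outcome_pmf_def
  by (intro bind_pmf_cong refl)
    (auto split: option.splits simp: map_bind_pmf map_pmf_comp intro!: bind_pmf_cong)

text \<open>The value \<open>0\<close> stands for not occupying \<open>u\<close> at all.\<close>

fun end_time :: "'u \<Rightarrow> nat \<times> 'u \<times> 'v \<times> nat \<times> outcome \<Rightarrow> nat" where
  "end_time u (s, u', v, l, Accepted d) = (if u' = u then s + d else 0)"
| "end_time u (s, u', v, l, Rejected) = 0"

text \<open>Translates what a policy observes into the hidden delays of the log. Rejected tasks and
  tasks of other machines have end time 0, which never exceeds \<open>t\<close>, so they drop out on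
  the right-hand side.\<close>

lemma Running_observe_iff:
  "(\<exists>s v l. (s, u, v, l, Running) \<in> set (observe t h)) \<longleftrightarrow> (\<exists>e\<in>set h. t < end_time u e)"
proof
  assume "\<exists>s v l. (s, u, v, l, Running) \<in> set (observe t h)"
  then obtain s v l z where "(s, u, v, l, z) \<in> set h" "feedback_at t s z = Running"
    by (fastforce simp: observe_def)
  then show "\<exists>e\<in>set h. t < end_time u e"
    by (intro bexI[of _ "(s, u, v, l, z)"]) (auto simp: feedback_at_def split: outcome.splits if_splits)
next
  assume "\<exists>e\<in>set h. t < end_time u e"
  then obtain s u' v l z where e: "(s, u', v, l, z) \<in> set h" "t < end_time u (s, u', v, l, z)"
    by (metis prod_cases5)
  then have "u' = u" "feedback_at t s z = Running"
    by (cases z; simp add: feedback_at_def split: if_splits)+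
  with e show "\<exists>s v l. (s, u, v, l, Running) \<in> set (observe t h)"
    by (force simp: observe_def)
qed

lemma available_observeD:
  "available G (observe t h) u \<Longrightarrow> e \<in> set h \<Longrightarrow> end_time u e \<le> t"
  using Running_observe_iff[of u t h] by (auto simp: available_def not_less[symmetric])

text \<open>Indexing by edges, with 0 for types that did not arrive, lets sums range over fixed sets
  while the arrival varies.\<close>

definition choice_prob ::
  "(nat \<Rightarrow> 'v option) \<Rightarrow> ('u, 'v) policy \<Rightarrow> nat \<Rightarrow> ('u, 'v) log \<Rightarrow> 'u \<times> 'v \<Rightarrow> nat \<Rightarrow> real" where
  "choice_prob I \<pi> t h e l =
     (if I t = Some (snd e) then pmf (\<pi> t (observe t h)) (Some (fst e, l)) else 0)"

lemma choice_prob_nonneg: "0 \<le> choice_prob I \<pi> t h e l"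
  by (simp add: choice_prob_def)

lemma choice_prob_le_1: "choice_prob I \<pi> t h e l \<le> 1"
  by (simp add: choice_prob_def pmf_le_1)

text \<open>The decision at \<open>t\<close> sees the log of the first \<open>t - 1\<close> steps.
  Averaged over arrival sequences, these numbers become the variables of the linear program.\<close>

definition assign_prob ::
  "('u, 'v) task_instance \<Rightarrow> (nat \<Rightarrow> 'v option) \<Rightarrow> ('u, 'v) policy \<Rightarrow> 'u \<times> 'v \<Rightarrow> nat \<Rightarrow> nat \<Rightarrow> real" where
  "assign_prob G I \<pi> e l t =
     measure_pmf.expectation (run G I \<pi> (t - 1)) (\<lambda>h. choice_prob I \<pi> t h e l)"

text \<open>The length bound makes additive functions of the log bounded, as required for
  integrability. Excluding \<open>Accepted 0\<close> guarantees that an accepted task occupies its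
  machine at least until the next step.\<close>

definition valid_log :: "('u, 'v) task_instance \<Rightarrow> nat \<Rightarrow> ('u, 'v) log \<Rightarrow> bool" where
  "valid_log G t h \<longleftrightarrow> length h \<le> t \<and>
     (\<forall>(s, u, v, l, z) \<in> set h. (u, v) \<in> edges G \<and> l \<in> levels G \<and> z \<noteq> Accepted 0)"

lemma abs_log_sum_le:
  fixes w :: "nat \<times> 'u \<times> 'v \<times> nat \<times> outcome \<Rightarrow> real"
  assumes "valid_log G t h" and "0 \<le> B"
    and w: "\<And>s u v l z. (u, v) \<in> edges G \<Longrightarrow> l \<in> levels G \<Longrightarrow> \<bar>w (s, u, v, l, z)\<bar> \<le> B"
  shows "\<bar>\<Sum>e\<leftarrow>h. w e\<bar> \<le> real t * B"
proof -
  have "\<bar>\<Sum>e\<leftarrow>h. w e\<bar> \<le> (\<Sum>e\<leftarrow>h. \<bar>w e\<bar>)"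
    by (rule sum_list_abs[of "map w h", unfolded map_map comp_def])
  also have "\<dots> \<le> (\<Sum>e\<leftarrow>h. B)"
    by (rule sum_list_mono) (use assms in \<open>auto simp: valid_log_def\<close>)
  also have "\<dots> = real (length h) * B"
    by (simp add: sum_list_triv)
  also have "\<dots> \<le> real t * B"
    using assms by (intro mult_right_mono) (auto simp: valid_log_def)
  finally show ?thesis .
qed

locale task_assignment =
  fixes G :: "('u, 'v) task_instance"
  assumes valid: "valid_instance G"
begin

lemma finite_machines: "finite (machines G)"
  using valid by (simp add: valid_instance_def)

lemma finite_task_types: "finite (task_types G)"
  using valid by (simp add: valid_instance_def)

lemma finite_edges: "finite (edges G)"
  by (rule finite_subset[of _ "machines G \<times> task_types G"])
    (use valid in \<open>auto simp: valid_instance_def\<close>)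

lemma finite_levels: "finite (levels G)"
  by (simp add: levels_def)

lemma edge_endpoints:
  "e \<in> edges G \<Longrightarrow> fst e \<in> machines G" "e \<in> edges G \<Longrightarrow> snd e \<in> task_types G"
  using valid by (auto simp: valid_instance_def)

lemma delay_pos: "l \<in> levels G \<Longrightarrow> 0 \<notin> set_pmf (delay G l)"
  using valid by (force simp: valid_instance_def)

lemma accept_prob_bounds:
  "e \<in> edges G \<Longrightarrow> 0 \<le> accept_prob G e" "e \<in> edges G \<Longrightarrow> accept_prob G e \<le> 1"
  using valid by (auto simp: valid_instance_def)

lemma reward_bounded:
  obtains B where "0 \<le> B"
    "\<And>u v l. (u, v) \<in> edges G \<Longrightarrow> l \<in> levels G \<Longrightarrow> \<bar>reward G u v l\<bar> \<le> B"
proof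
  let ?B = "\<Sum>(e, l)\<in>edges G \<times> levels G. \<bar>reward G (fst e) (snd e) l\<bar>"
  show "0 \<le> ?B" by (auto intro: sum_nonneg)
  show "\<bar>reward G u v l\<bar> \<le> ?B" if "(u, v) \<in> edges G" "l \<in> levels G" for u v l
    using member_le_sum[of "((u, v), l)" "edges G \<times> levels G" "\<lambda>(e, l). \<bar>reward G (fst e) (snd e) l\<bar>"]
      that finite_edges finite_levels by auto
qed

section \<open>Arrival distributions: finiteness and marginals\<close>

abbreviation arrival_at :: "nat \<Rightarrow> 'v option pmf" where
  "arrival_at t \<equiv> sub_pmf (task_types G) (\<lambda>v. arrival_prob G v t)"

lemma finite_set_arrival_at:
  assumes "t \<in> times G"
  shows "finite (set_pmf (arrival_at t))"
proof (rule finite_subset)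
  show "finite (insert None (Some ` task_types G))"
    using finite_task_types by simp
  have "pmf (arrival_at t) z = 0" if "z \<notin> insert None (Some ` task_types G)" for z
    by (subst pmf_sub_pmf)
      (use valid assms that in \<open>auto simp: valid_instance_def split: option.splits\<close>)
  then show "set_pmf (arrival_at t) \<subseteq> insert None (Some ` task_types G)"
    by (metis (lifting) set_pmf_iff subsetI)
qed

lemma expectation_arrival_at:
  assumes "t \<in> times G" "v \<in> task_types G"
  shows "measure_pmf.expectation (arrival_at t) (\<lambda>z. if z = Some v then c else 0)
    = c * arrival_prob G v t"
proof -
  have "pmf (arrival_at t) (Some v) = arrival_prob G v t"
    by (subst pmf_sub_pmf) (use valid assms in \<open>auto simp: valid_instance_def\<close>)
  moreover have "measure_pmf.expectation (arrival_at t) (\<lambda>z. if z = Some v then c else 0)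
      = (\<Sum>z\<in>{Some v}. (if z = Some v then c else 0) * pmf (arrival_at t) z)"
    by (rule integral_measure_pmf_real) (auto split: if_splits)
  ultimately show ?thesis by simp
qed

text \<open>There are finitely many times and task types, so every real function of the arrival
  sequence is integrable, including \<open>OPT G\<close>, about whose dependence on the sequence
  nothing else is known.\<close>

lemma finite_set_arrivals: "finite (set_pmf (arrivals G))"
  unfolding arrivals_def
  by (subst set_Pi_pmf) (auto simp: times_def intro!: finite_PiE_dflt finite_set_arrival_at)

lemma integrable_arrivals: "integrable (measure_pmf (arrivals G)) (f :: _ \<Rightarrow> real)"
  by (rule integrable_measure_pmf_finite) (rule finite_set_arrivals)

lemma expectation_arrivals_component:
  assumes "t \<in> times G" "v \<in> task_types G"
  shows "measure_pmf.expectation (arrivals G) (\<lambda>I. if I t = Some v then c else 0)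
    = c * arrival_prob G v t"
proof -
  have "measure_pmf.expectation (arrivals G) (\<lambda>I. if I t = Some v then c else 0)
      = measure_pmf.expectation (map_pmf (\<lambda>I. I t) (arrivals G)) (\<lambda>z. if z = Some v then c else 0)"
    by simp
  also have "map_pmf (\<lambda>I. I t) (arrivals G) = arrival_at t"
    using assms unfolding arrivals_def by (subst Pi_pmf_component) (auto simp: times_def)
  finally have "measure_pmf.expectation (arrivals G) (\<lambda>I. if I t = Some v then c else 0)
      = measure_pmf.expectation (arrival_at t) (\<lambda>z. if z = Some v then c else 0)" .
  then show ?thesis
    using assms by (simp add: expectation_arrival_at)
qed

lemma expectation_outcome:
  assumes e: "e \<in> edges G"
    and B: "\<And>z. z \<in> set_pmf (outcome_pmf G e l) \<Longrightarrow> \<bar>f z\<bar> \<le> B"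
  shows "measure_pmf.expectation (outcome_pmf G e l) f
    = accept_prob G e * measure_pmf.expectation (delay G l) (\<lambda>d. f (Accepted d))
      + (1 - accept_prob G e) * f Rejected"
proof -
  have "measure_pmf.expectation (outcome_pmf G e l) f
      = measure_pmf.expectation (bernoulli_pmf (accept_prob G e)) (\<lambda>b. measure_pmf.expectation
          (if b then map_pmf Accepted (delay G l) else return_pmf Rejected) f)"
    unfolding outcome_pmf_def
    by (rule integral_bind_pmf_bounded) (use B in \<open>auto simp: outcome_pmf_def\<close>)
  then show ?thesis
    using accept_prob_bounds[OF e] by simp
qed

lemma outcome_not_Accepted_0:
  "l \<in> levels G \<Longrightarrow> Accepted 0 \<notin> set_pmf (outcome_pmf G e l)"
  using delay_pos[of l] by (auto simp: outcome_pmf_def split: if_splits)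

lemma set_step_cases:
  assumes "admissible G I \<pi>" "t \<in> times G" "h' \<in> set_pmf (step G I \<pi> t h)"
  obtains "h' = h"
  | u v l z where "I t = Some v" "(u, v) \<in> edges G" "l \<in> levels G" "available G (observe t h) u"
      "z \<in> set_pmf (outcome_pmf G (u, v) l)" "h' = h @ [(t, u, v, l, z)]"
proof -
  obtain a where a: "a \<in> set_pmf (\<pi> t (observe t h))"
    "h' \<in> set_pmf (case (a, I t) of
      (Some (u, l), Some v) \<Rightarrow> map_pmf (\<lambda>z. h @ [(t, u, v, l, z)]) (outcome_pmf G (u, v) l)
    | _ \<Rightarrow> return_pmf h)"
    using assms(3) unfolding step_eq by auto
  have "a \<in> legal_actions G I t (observe t h)"
    using a(1) assms(1,2) by (auto simp: admissible_def)
  then show thesis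
    using a(2) that by (auto simp: legal_actions_def split: option.splits)
qed

lemma valid_log_step:
  assumes "admissible G I \<pi>" "Suc t \<in> times G" "valid_log G t h"
    and "h' \<in> set_pmf (step G I \<pi> (Suc t) h)"
  shows "valid_log G (Suc t) h'"
  using assms(1,2,4)
proof (cases rule: set_step_cases)
  case 1
  then show ?thesis using assms(3) by (auto simp: valid_log_def)
next
  case 2
  then show ?thesis using assms(3) outcome_not_Accepted_0 by (auto simp: valid_log_def)
qed

lemma valid_log_run:
  assumes "admissible G I \<pi>"
  shows "t \<le> horizon G \<Longrightarrow> h \<in> set_pmf (run G I \<pi> t) \<Longrightarrow> valid_log G t h"
proof (induction t arbitrary: h)
  case 0
  then show ?case by (simp add: valid_log_def)
next
  case (Suc t)
  then obtain h0 where "h0 \<in> set_pmf (run G I \<pi> t)" "h \<in> set_pmf (step G I \<pi> (Suc t) h0)"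
    by auto
  then show ?case
    using Suc valid_log_step[OF assms, of t h0 h] by (auto simp: times_def)
qed

section \<open>Expectations along a run of an arbitrary admissible policy\<close>

lemma sum_type_edges:
  fixes g :: "'u \<times> 'v \<Rightarrow> nat \<Rightarrow> real"
  shows "(\<Sum>(u, l)\<in>{(u, l). (u, v) \<in> edges G \<and> l \<in> levels G}. g (u, v) l)
    = (\<Sum>e\<in>type_edges G v. \<Sum>l\<in>levels G. g e l)"
proof -
  have "(\<Sum>(u, l)\<in>{(u, l). (u, v) \<in> edges G \<and> l \<in> levels G}. g (u, v) l)
      = (\<Sum>(e, l)\<in>type_edges G v \<times> levels G. g e l)"
    by (rule sum.reindex_bij_witness[of _ "\<lambda>(e, l). (fst e, l)" "\<lambda>(u, l). ((u, v), l)"])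
      (auto simp: type_edges_def)
  then show ?thesis
    by (simp add: sum.cartesian_product)
qed

lemma finite_assignments: "finite {(u, l). (u, v) \<in> edges G \<and> l \<in> levels G}"
  by (rule finite_subset[of _ "fst ` edges G \<times> levels G"])
    (use finite_edges finite_levels in \<open>auto simp: image_iff\<close>, force)

lemma sum_choice_prob:
  fixes g :: "'u \<times> 'v \<Rightarrow> nat \<Rightarrow> real"
  shows "(\<Sum>e\<in>edges G. \<Sum>l\<in>levels G. choice_prob I \<pi> t h e l * g e l) = (case I t of
      None \<Rightarrow> 0
    | Some v \<Rightarrow> (\<Sum>(u, l)\<in>{(u, l). (u, v) \<in> edges G \<and> l \<in> levels G}.
        pmf (\<pi> t (observe t h)) (Some (u, l)) * g (u, v) l))"
proof (cases "I t")
  case None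
  then show ?thesis by (simp add: choice_prob_def)
next
  case (Some v)
  have "(\<Sum>e\<in>edges G. \<Sum>l\<in>levels G. choice_prob I \<pi> t h e l * g e l)
      = (\<Sum>e\<in>type_edges G v. \<Sum>l\<in>levels G. pmf (\<pi> t (observe t h)) (Some (fst e, l)) * g e l)"
    unfolding type_edges_def sum.inter_filter[OF finite_edges]
    by (intro sum.cong) (auto simp: choice_prob_def Some)
  then show ?thesis
    by (simp add: Some sum_type_edges[symmetric, where v = v])
qed

text \<open>Discarding leaves the log unchanged, so \<open>f h\<close> is the baseline and every
  possible assignment adds its probability times its expected change of \<open>f\<close>. It serves
  both for additive functions of the log and for the potential of OMLA.\<close>

lemma expectation_step:
  assumes adm: "admissible G I \<pi>" and t: "t \<in> times G"
    and B: "\<And>h'. h' \<in> set_pmf (step G I \<pi> t h) \<Longrightarrow> \<bar>f h'\<bar> \<le> B"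
  shows "measure_pmf.expectation (step G I \<pi> t h) f
    = f h + (\<Sum>e\<in>edges G. \<Sum>l\<in>levels G. choice_prob I \<pi> t h e l *
        (measure_pmf.expectation (outcome_pmf G e l) (\<lambda>z. f (h @ [(t, fst e, snd e, l, z)])) - f h))"
proof -
  let ?p = "\<pi> t (observe t h)"
  let ?k = "\<lambda>a. case (a, I t) of
      (Some (u, l), Some v) \<Rightarrow> map_pmf (\<lambda>z. h @ [(t, u, v, l, z)]) (outcome_pmf G (u, v) l)
    | _ \<Rightarrow> return_pmf h"
  have E: "measure_pmf.expectation (step G I \<pi> t h) f
      = measure_pmf.expectation ?p (\<lambda>a. measure_pmf.expectation (?k a) f)"
    unfolding step_eq
    by (rule integral_bind_pmf_bounded) (use B in \<open>simp add: step_eq\<close>)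
  show ?thesis
  proof (cases "I t")
    case None
    then have "?k = (\<lambda>a. return_pmf h)" by (auto split: option.splits)
    then show ?thesis using None unfolding E by (simp add: choice_prob_def)
  next
    case (Some v)
    let ?S = "{(u, l). (u, v) \<in> edges G \<and> l \<in> levels G}"
    have "set_pmf ?p \<subseteq> legal_actions G I t (observe t h)"
      using adm t by (simp add: admissible_def)
    also have "\<dots> \<subseteq> insert None (Some ` ?S)"
      by (auto simp: legal_actions_def Some)
    finally have "set_pmf ?p \<subseteq> insert None (Some ` ?S)" .
    then have "measure_pmf.expectation ?p (\<lambda>a. measure_pmf.expectation (?k a) f)
        = f h + (\<Sum>a\<in>?S. pmf ?p (Some a) * (measure_pmf.expectation (?k (Some a)) f - f h))"
      by (subst expectation_option_pmf[OF finite_assignments]) auto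
    then show ?thesis
      unfolding E sum_choice_prob by (auto simp: Some intro!: sum.cong)
  qed
qed

text \<open>A Wald-type identity: the outcome of an assignment is drawn independently of the
  decision to make it, so each assignment contributes its probability times the mean weight. It is
  used with the reward as weight and with the indicator of a task still running.\<close>

lemma expectation_log_sum:
  fixes w :: "nat \<times> 'u \<times> 'v \<times> nat \<times> outcome \<Rightarrow> real"
  assumes adm: "admissible G I \<pi>"
    and w: "\<And>s u v l z. (u, v) \<in> edges G \<Longrightarrow> l \<in> levels G \<Longrightarrow> \<bar>w (s, u, v, l, z)\<bar> \<le> B"
    and "0 \<le> B"
  shows "t \<le> horizon G \<Longrightarrow> measure_pmf.expectation (run G I \<pi> t) (\<lambda>h. \<Sum>e\<leftarrow>h. w e)
    = (\<Sum>s\<in>{1..t}. \<Sum>e\<in>edges G. \<Sum>l\<in>levels G. assign_prob G I \<pi> e l s *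
        measure_pmf.expectation (outcome_pmf G e l) (\<lambda>z. w (s, fst e, snd e, l, z)))"
proof (induction t)
  case 0
  then show ?case by simp
next
  case (Suc t)
  let ?W = "\<lambda>h. \<Sum>e\<leftarrow>h. w e"
  define c where "c s = (\<Sum>e\<in>edges G. \<Sum>l\<in>levels G. assign_prob G I \<pi> e l s *
        measure_pmf.expectation (outcome_pmf G e l) (\<lambda>z. w (s, fst e, snd e, l, z)))" for s
  let ?m = "\<lambda>e l. measure_pmf.expectation (outcome_pmf G e l) (\<lambda>z. w (Suc t, fst e, snd e, l, z))"
  have t: "Suc t \<in> times G" using Suc.prems by (simp add: times_def)
  have bound: "\<bar>?W h\<bar> \<le> real s * B" if "s \<le> horizon G" "h \<in> set_pmf (run G I \<pi> s)" for s h
    by (rule abs_log_sum_le[where w = w, OF valid_log_run[OF adm that] \<open>0 \<le> B\<close>]) (rule w)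
  have step: "measure_pmf.expectation (step G I \<pi> (Suc t) h) ?W
      = ?W h + (\<Sum>e\<in>edges G. \<Sum>l\<in>levels G. choice_prob I \<pi> (Suc t) h e l * ?m e l)"
    if h: "h \<in> set_pmf (run G I \<pi> t)" for h
  proof -
    have "\<bar>?W h'\<bar> \<le> real (Suc t) * B" if "h' \<in> set_pmf (step G I \<pi> (Suc t) h)" for h'
      by (rule bound) (use Suc.prems h that in auto)
    moreover have "measure_pmf.expectation (outcome_pmf G e l)
        (\<lambda>z. ?W (h @ [(Suc t, fst e, snd e, l, z)])) - ?W h = ?m e l"
      if "e \<in> edges G" "l \<in> levels G" for e l
    proof -
      have "integrable (measure_pmf (outcome_pmf G e l)) (\<lambda>z. w (Suc t, fst e, snd e, l, z))"
        by (rule integrable_measure_pmf_bounded[where B = B]) (use that w in auto)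
      then show ?thesis by simp
    qed
    ultimately show ?thesis
      by (subst expectation_step[OF adm t]) (auto intro!: sum.cong)
  qed
  have int: "integrable (measure_pmf (run G I \<pi> t)) ?W"
    by (rule integrable_measure_pmf_bounded[where B = "real t * B"])
      (use bound[of t] Suc.prems in simp)
  have int': "integrable (measure_pmf (run G I \<pi> t)) (\<lambda>h. choice_prob I \<pi> (Suc t) h e l)" for e l
    by (rule integrable_measure_pmf_bounded[where B = 1])
      (simp add: choice_prob_nonneg choice_prob_le_1)
  have "measure_pmf.expectation (run G I \<pi> (Suc t)) ?W
      = measure_pmf.expectation (run G I \<pi> t) (\<lambda>h. measure_pmf.expectation (step G I \<pi> (Suc t) h) ?W)"
    unfolding run.simps
    by (rule integral_bind_pmf_bounded[where B = "real (Suc t) * B"])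
      (use bound[OF Suc.prems] in simp)
  also have "\<dots> = measure_pmf.expectation (run G I \<pi> t)
      (\<lambda>h. ?W h + (\<Sum>e\<in>edges G. \<Sum>l\<in>levels G. choice_prob I \<pi> (Suc t) h e l * ?m e l))"
    by (rule integral_cong_pmf) (rule step)
  also have "\<dots> = measure_pmf.expectation (run G I \<pi> t) ?W
      + c (Suc t)"
    using int int' by (simp add: assign_prob_def c_def)
  also have "measure_pmf.expectation (run G I \<pi> t) ?W = (\<Sum>s\<in>{1..t}. c s)"
    unfolding c_def by (rule Suc.IH) (use Suc.prems in simp)
  also have "(\<Sum>s\<in>{1..t}. c s) + c (Suc t) = (\<Sum>s\<in>{1..Suc t}. c s)"
    by simp
  finally show ?case
    unfolding c_def .
qed

section \<open>The linear program bounds the benchmark\<close>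

lemma policy_value_eq:
  assumes "admissible G I \<pi>"
  shows "policy_value G I \<pi> = (\<Sum>t\<in>times G. \<Sum>e\<in>edges G. \<Sum>l\<in>levels G.
    assign_prob G I \<pi> e l t * (accept_prob G e * reward G (fst e) (snd e) l))"
proof -
  let ?w = "\<lambda>(s, u, v, l, z). case z of Rejected \<Rightarrow> 0 | Accepted d \<Rightarrow> reward G u v l"
  obtain B where B: "0 \<le> B"
    "\<And>u v l. (u, v) \<in> edges G \<Longrightarrow> l \<in> levels G \<Longrightarrow> \<bar>reward G u v l\<bar> \<le> B"
    by (rule reward_bounded) blast
  have m: "measure_pmf.expectation (outcome_pmf G e l) (\<lambda>z. ?w (s, fst e, snd e, l, z))
      = accept_prob G e * reward G (fst e) (snd e) l" if "e \<in> edges G" "l \<in> levels G" for e l s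
    by (subst expectation_outcome[where B = B]) (use that B in \<open>auto split: outcome.splits\<close>)
  have "policy_value G I \<pi> = measure_pmf.expectation (run G I \<pi> (horizon G)) (\<lambda>h. \<Sum>e\<leftarrow>h. ?w e)"
    by (simp add: policy_value_def total_reward_def[abs_def])
  also have "\<dots> = (\<Sum>s\<in>{1..horizon G}. \<Sum>e\<in>edges G. \<Sum>l\<in>levels G. assign_prob G I \<pi> e l s *
        measure_pmf.expectation (outcome_pmf G e l) (\<lambda>z. ?w (s, fst e, snd e, l, z)))"
    by (rule expectation_log_sum[where B = B]) (use assms B in \<open>auto split: outcome.splits\<close>)
  also have "\<dots> = (\<Sum>t\<in>times G. \<Sum>e\<in>edges G. \<Sum>l\<in>levels G.
      assign_prob G I \<pi> e l t * (accept_prob G e * reward G (fst e) (snd e) l))"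
    unfolding times_def by (intro sum.cong refl) (simp only: m)
  finally show ?thesis .
qed

lemma assign_prob_bounds:
  "0 \<le> assign_prob G I \<pi> e l t" "assign_prob G I \<pi> e l t \<le> 1"
proof -
  have "\<bar>choice_prob I \<pi> t h e l\<bar> \<le> 1" for h
    by (simp add: choice_prob_nonneg choice_prob_le_1)
  then show "assign_prob G I \<pi> e l t \<le> 1"
    unfolding assign_prob_def by (metis abs_expectation_le abs_le_D1)
  show "0 \<le> assign_prob G I \<pi> e l t"
    unfolding assign_prob_def by (simp add: choice_prob_nonneg)
qed

lemma sum_choice_prob_le_1:
  assumes "E \<subseteq> edges G"
  shows "(\<Sum>e\<in>E. \<Sum>l\<in>levels G. choice_prob I \<pi> t h e l) \<le> 1"
proof -
  have "(\<Sum>e\<in>E. \<Sum>l\<in>levels G. choice_prob I \<pi> t h e l)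
      \<le> (\<Sum>e\<in>edges G. \<Sum>l\<in>levels G. choice_prob I \<pi> t h e l * 1)"
    by (simp, rule sum_mono2[OF finite_edges assms]) (auto intro: sum_nonneg choice_prob_nonneg)
  also have "\<dots> \<le> 1"
  proof (cases "I t")
    case None
    then show ?thesis unfolding sum_choice_prob by simp
  next
    case (Some v)
    let ?S = "{(u, l). (u, v) \<in> edges G \<and> l \<in> levels G}"
    have "(\<Sum>a\<in>?S. pmf (\<pi> t (observe t h)) (Some a))
        = measure_pmf.prob (\<pi> t (observe t h)) (Some ` ?S)"
      using finite_assignments[of v] by (subst measure_measure_pmf_finite) (auto simp: sum.reindex)
    then show ?thesis
      unfolding sum_choice_prob by (simp add: Some case_prod_unfold)
  qed
  finally show ?thesis .
qed

lemma sum_assign_prob_le: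
  assumes "E \<subseteq> edges G" and "\<And>h. (\<Sum>e\<in>E. \<Sum>l\<in>levels G. choice_prob I \<pi> t h e l) \<le> c"
  shows "(\<Sum>e\<in>E. \<Sum>l\<in>levels G. assign_prob G I \<pi> e l t) \<le> c"
proof -
  have int: "integrable (measure_pmf (run G I \<pi> (t - 1))) (\<lambda>h. choice_prob I \<pi> t h e l)" for e l
    by (rule integrable_measure_pmf_bounded[where B = 1])
      (simp add: choice_prob_nonneg choice_prob_le_1)
  then have "(\<Sum>e\<in>E. \<Sum>l\<in>levels G. assign_prob G I \<pi> e l t)
      = measure_pmf.expectation (run G I \<pi> (t - 1)) (\<lambda>h. \<Sum>e\<in>E. \<Sum>l\<in>levels G. choice_prob I \<pi> t h e l)"
    by (simp add: assign_prob_def)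
  also have "\<dots> \<le> c"
    by (rule measure_pmf.integral_le_const) (use int assms(2) in auto)
  finally show ?thesis .
qed

text \<open>The reference time \<open>t'\<close> stays fixed while the log grows up to
  \<open>t \<le> t'\<close>. A new task on \<open>u\<close> requires \<open>u\<close> to be
  available, so all earlier tasks of \<open>u\<close> have ended by then and none of them runs
  beyond \<open>t'\<close>.\<close>

lemma running_le_1:
  assumes adm: "admissible G I \<pi>"
  shows "t \<le> horizon G \<Longrightarrow> h \<in> set_pmf (run G I \<pi> t) \<Longrightarrow> t \<le> t' \<Longrightarrow>
    length (filter (\<lambda>e. t' < end_time u e) h) \<le> 1"
proof (induction t arbitrary: h)
  case 0
  then show ?case by simp
next
  case (Suc t)
  then obtain h0 where h0: "h0 \<in> set_pmf (run G I \<pi> t)" "h \<in> set_pmf (step G I \<pi> (Suc t) h0)"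
    by auto
  have IH: "length (filter (\<lambda>e. t' < end_time u e) h0) \<le> 1"
    using Suc h0(1) by auto
  have "Suc t \<in> times G" using Suc.prems by (simp add: times_def)
  from adm this h0(2) show ?case
  proof (cases rule: set_step_cases)
    case 1
    then show ?thesis using IH by simp
  next
    case (2 u' v l z)
    show ?thesis
    proof (cases "u' = u")
      case True
      then have "filter (\<lambda>e. t' < end_time u e) h0 = []"
        using available_observeD[OF 2(4)] Suc.prems(3) by (fastforce simp: filter_empty_conv)
      then show ?thesis using 2 by simp
    next
      case False
      then have "end_time u (Suc t, u', v, l, z) = 0" by (cases z) auto
      then show ?thesis using IH 2 by simp
    qed
  qed
qed

lemma expectation_running:
  assumes "e \<in> edges G" "s \<le> t"
  shows "measure_pmf.expectation (outcome_pmf G e l)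
      (\<lambda>z. of_bool (t < end_time u (s, fst e, snd e, l, z)))
    = (if fst e = u then accept_prob G e * measure_pmf.prob (delay G l) {t - s + 1..} else 0)"
proof -
  have "(\<lambda>d. of_bool (t < s + d) :: real) = indicator {t - s + 1..}"
    using assms(2) by (auto simp: indicator_def fun_eq_iff)
  then show ?thesis
    by (subst expectation_outcome[OF assms(1), where B = 1]) auto
qed

text \<open>The left-hand side is the expected number of tasks of \<open>u\<close> running beyond
  \<open>t\<close>, and on every reachable log this number is at most 1. The sequence
  \<open>I\<close> is fixed, so the bound holds for clairvoyant policies. The term
  \<open>s = t\<close> carries the probability of a delay at least 1, that is 1, and is the separate
  summand of the program.\<close>

lemma capacity_constraint:
  assumes adm: "admissible G I \<pi>" and t: "t \<in> times G"
  shows "(\<Sum>s\<in>{1..t}. \<Sum>e\<in>machine_edges G u. accept_prob G e * (\<Sum>l\<in>levels G.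
    assign_prob G I \<pi> e l s * measure_pmf.prob (delay G l) {t - s + 1..})) \<le> 1"
proof -
  let ?w = "\<lambda>e. of_bool (t < end_time u e) :: real"
  have t': "t \<le> horizon G" using t by (simp add: times_def)
  have count: "(\<Sum>e\<leftarrow>h. ?w e) = real (length (filter (\<lambda>e. t < end_time u e) h))" for h
    by (induction h) auto
  have "(\<Sum>s\<in>{1..t}. \<Sum>e\<in>machine_edges G u. accept_prob G e * (\<Sum>l\<in>levels G.
      assign_prob G I \<pi> e l s * measure_pmf.prob (delay G l) {t - s + 1..}))
    = (\<Sum>s\<in>{1..t}. \<Sum>e\<in>edges G. \<Sum>l\<in>levels G. assign_prob G I \<pi> e l s *
        measure_pmf.expectation (outcome_pmf G e l) (\<lambda>z. ?w (s, fst e, snd e, l, z)))"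
    unfolding machine_edges_def sum.inter_filter[OF finite_edges]
    by (intro sum.cong refl) (auto simp: expectation_running sum_distrib_left mult_ac)
  also have "\<dots> = measure_pmf.expectation (run G I \<pi> t) (\<lambda>h. \<Sum>e\<leftarrow>h. ?w e)"
    by (rule expectation_log_sum[symmetric, where B = 1]) (use adm t' in auto)
  also have "\<dots> \<le> 1"
  proof -
    have le: "(\<Sum>e\<leftarrow>h. ?w e) \<le> 1" if "h \<in> set_pmf (run G I \<pi> t)" for h
      using running_le_1[OF adm t' that order_refl] unfolding count by simp
    have "integrable (measure_pmf (run G I \<pi> t)) (\<lambda>h. \<Sum>e\<leftarrow>h. ?w e)"
      by (rule integrable_measure_pmf_bounded[where B = 1]) (use le in \<open>simp add: count\<close>)
    then show ?thesis
      by (rule measure_pmf.integral_le_const) (use le in \<open>auto simp: AE_measure_pmf_iff\<close>)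
  qed
  finally show ?thesis .
qed

lemma type_edges_subset: "type_edges G v \<subseteq> edges G"
  by (auto simp: type_edges_def)

lemma machine_edges_subset: "machine_edges G u \<subseteq> edges G"
  by (auto simp: machine_edges_def)

text \<open>The policies may be chosen separately for each \<open>I\<close>, since the constraints
  are linear and are verified before averaging. For the constraint on a type \<open>v\<close>, the
  bound for a fixed sequence is the indicator that \<open>v\<close> arrives at \<open>t\<close>,
  whose mean is \<open>arrival_prob G v t\<close>.\<close>

lemma lp_feasible_mean_assign_prob:
  assumes adm: "\<And>I. admissible G I (\<pi> I)"
    and infinite_budget: "\<forall>u \<in> machines G. budget G u = \<infinity>"
  shows "lp_feasible G (\<lambda>e l t. measure_pmf.expectation (arrivals G) (\<lambda>I. assign_prob G I (\<pi> I) e l t))"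
    (is "lp_feasible G ?y")
proof -
  note [simp] = integrable_arrivals
  have nonneg: "0 \<le> ?y e l t" for e l t
    by (simp add: assign_prob_bounds)
  have capacity: "(\<Sum>s\<in>{1..<t}. \<Sum>e\<in>machine_edges G u. accept_prob G e *
         (\<Sum>l\<in>levels G. ?y e l s * measure_pmf.prob (delay G l) {t - s + 1..}))
      + (\<Sum>e\<in>machine_edges G u. accept_prob G e * (\<Sum>l\<in>levels G. ?y e l t)) \<le> 1"
    if t: "t \<in> times G" for u t
  proof -
    have 1: "measure_pmf.prob (delay G l) {Suc 0..} = 1" if "l \<in> levels G" for l
      using delay_pos[OF that] by (intro measure_pmf.prob_eq_1[THEN iffD2])
        (auto simp: AE_measure_pmf_iff Suc_le_eq intro: gr0I)
    have "{1..t} = insert t {1..<t}" using t by (auto simp: times_def)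
    then have "(\<Sum>s\<in>{1..<t}. \<Sum>e\<in>machine_edges G u. accept_prob G e *
         (\<Sum>l\<in>levels G. ?y e l s * measure_pmf.prob (delay G l) {t - s + 1..}))
      + (\<Sum>e\<in>machine_edges G u. accept_prob G e * (\<Sum>l\<in>levels G. ?y e l t))
      = (\<Sum>s\<in>{1..t}. \<Sum>e\<in>machine_edges G u. accept_prob G e *
         (\<Sum>l\<in>levels G. ?y e l s * measure_pmf.prob (delay G l) {t - s + 1..}))"
      by (simp add: 1)
    also have "\<dots> = measure_pmf.expectation (arrivals G) (\<lambda>I.
        \<Sum>s\<in>{1..t}. \<Sum>e\<in>machine_edges G u. accept_prob G e *
         (\<Sum>l\<in>levels G. assign_prob G I (\<pi> I) e l s * measure_pmf.prob (delay G l) {t - s + 1..}))"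
      by simp
    also have "\<dots> \<le> 1"
      by (rule measure_pmf.integral_le_const) (use capacity_constraint[OF adm t] in auto)
    finally show ?thesis .
  qed
  have type: "(\<Sum>e\<in>type_edges G v. \<Sum>l\<in>levels G. ?y e l t) \<le> arrival_prob G v t"
    if "v \<in> task_types G" "t \<in> times G" for v t
  proof -
    have "(\<Sum>e\<in>type_edges G v. \<Sum>l\<in>levels G. choice_prob I (\<pi> I) t h e l)
        \<le> (if I t = Some v then 1 else 0)" for I h
    proof (cases "I t = Some v")
      case True
      then show ?thesis using sum_choice_prob_le_1[OF type_edges_subset] by simp
    next
      case False
      then have "choice_prob I (\<pi> I) t h e l = 0" if "e \<in> type_edges G v" for e l
        using that by (simp add: choice_prob_def type_edges_def)
      then show ?thesis by simp
    qed
    then have le: "(\<Sum>e\<in>type_edges G v. \<Sum>l\<in>levels G. assign_prob G I (\<pi> I) e l t)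
        \<le> (if I t = Some v then 1 else 0)" for I
      by (intro sum_assign_prob_le type_edges_subset)
    have "(\<Sum>e\<in>type_edges G v. \<Sum>l\<in>levels G. ?y e l t) = measure_pmf.expectation (arrivals G)
        (\<lambda>I. \<Sum>e\<in>type_edges G v. \<Sum>l\<in>levels G. assign_prob G I (\<pi> I) e l t)"
      by simp
    also have "\<dots> \<le> measure_pmf.expectation (arrivals G) (\<lambda>I. if I t = Some v then 1 else 0)"
      by (intro integral_mono le) simp_all
    finally show ?thesis
      using that by (simp add: expectation_arrivals_component)
  qed
  have edge: "(\<Sum>l\<in>levels G. ?y e l t) \<le> arrival_prob G v t"
    if "v \<in> task_types G" "t \<in> times G" "e \<in> type_edges G v" for v t e
  proof -
    have "(\<Sum>l\<in>levels G. ?y e l t) \<le> (\<Sum>e\<in>type_edges G v. \<Sum>l\<in>levels G. ?y e l t)"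
      using that(3) finite_subset[OF type_edges_subset finite_edges]
      by (intro member_le_sum sum_nonneg nonneg) auto
    then show ?thesis using type[OF that(1,2)] by linarith
  qed
  have machine: "(\<Sum>e\<in>machine_edges G u. \<Sum>l\<in>levels G. ?y e l t) \<le> 1" for u t
  proof -
    have "(\<Sum>e\<in>machine_edges G u. \<Sum>l\<in>levels G. ?y e l t) = measure_pmf.expectation (arrivals G)
        (\<lambda>I. \<Sum>e\<in>machine_edges G u. \<Sum>l\<in>levels G. assign_prob G I (\<pi> I) e l t)"
      by simp
    also have "\<dots> \<le> 1"
      by (rule measure_pmf.integral_le_const)
        (auto intro!: sum_assign_prob_le sum_choice_prob_le_1 machine_edges_subset)
    finally show ?thesis .
  qed
  show ?thesis
    unfolding lp_feasible_def
    by (intro conjI ballI allI impI sum_nonneg nonneg capacity type edge machine)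
      (use infinite_budget in auto)
qed

lemma admissible_discard: "admissible G I (\<lambda>_ _. return_pmf None)"
  by (simp add: admissible_def legal_actions_def)

text \<open>The supremum in \<open>OPT\<close> need not be attained, so an
  \<open>\<epsilon>\<close>-optimal policy is chosen for each sequence; the mean value of these
  policies is the objective at the feasible point of their averaged assignment
  probabilities.\<close>

lemma expectation_OPT_le_lp:
  assumes infinite_budget: "\<forall>u \<in> machines G. budget G u = \<infinity>" and x: "lp_optimal G x"
  shows "measure_pmf.expectation (arrivals G) (OPT G) \<le> lp_objective G x"
proof (rule field_le_epsilon)
  fix \<epsilon> :: real assume "0 < \<epsilon>"
  have "\<exists>\<pi>. admissible G I \<pi> \<and> OPT G I - \<epsilon> < policy_value G I \<pi>" for I
  proof -
    have "\<exists>y\<in>policy_value G I ` {\<pi>. admissible G I \<pi>}. OPT G I - \<epsilon> < y"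
      by (rule less_cSupD) (use admissible_discard \<open>0 < \<epsilon>\<close> in \<open>auto simp: OPT_def\<close>)
    then show ?thesis by auto
  qed
  then obtain \<pi> where \<pi>: "\<And>I. admissible G I (\<pi> I)"
    "\<And>I. OPT G I - \<epsilon> < policy_value G I (\<pi> I)"
    by metis
  let ?y = "\<lambda>e l t. measure_pmf.expectation (arrivals G) (\<lambda>I. assign_prob G I (\<pi> I) e l t)"
  note [simp] = integrable_arrivals
  have "measure_pmf.expectation (arrivals G) (OPT G)
      \<le> measure_pmf.expectation (arrivals G) (\<lambda>I. policy_value G I (\<pi> I) + \<epsilon>)"
    by (intro integral_mono) (use \<pi>(2) in \<open>auto simp: less_imp_le diff_less_eq\<close>)
  also have "\<dots> = measure_pmf.expectation (arrivals G) (\<lambda>I. policy_value G I (\<pi> I)) + \<epsilon>"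
    by simp
  also have "measure_pmf.expectation (arrivals G) (\<lambda>I. policy_value G I (\<pi> I)) = lp_objective G ?y"
    by (simp add: policy_value_eq[OF \<pi>(1)] lp_objective_def case_prod_unfold sum_distrib_left mult_ac)
  also have "\<dots> \<le> lp_objective G x"
    using x lp_feasible_mean_assign_prob[OF \<pi>(1) infinite_budget] by (simp add: lp_optimal_def)
  finally show "measure_pmf.expectation (arrivals G) (OPT G) \<le> lp_objective G x + \<epsilon>" by simp
qed

end

section \<open>The expected reward of OMLA\<close>

text \<open>The inserted 0 covers a machine that was never occupied. With infinite budget this
  single number determines availability at all later times.\<close>

definition release :: "'u \<Rightarrow> ('u, 'v) log \<Rightarrow> nat" where
  "release u h = Max (insert 0 (end_time u ` set h))"

lemma release_Nil [simp]: "release u [] = 0"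
  by (simp add: release_def)

lemma release_append: "release u (h @ [e]) = max (end_time u e) (release u h)"
proof -
  have *: "insert 0 (end_time u ` set (h @ [e])) = insert (end_time u e) (insert 0 (end_time u ` set h))"
    by auto
  show ?thesis
    unfolding release_def * by (rule Max_insert) auto
qed

lemma available_observe_iff:
  assumes "budget G u = \<infinity>"
  shows "available G (observe t h) u \<longleftrightarrow> release u h \<le> t"
  unfolding available_def Running_observe_iff release_def
  using assms by (auto simp: not_less)

lemma step_cong:
  assumes "I t = J t" "\<pi> t = \<rho> t"
  shows "step G I \<pi> t h = step G J \<rho> t h"
  by (simp add: step_def assms)

lemma run_cong:
  assumes "\<And>s. s \<in> {1..t} \<Longrightarrow> I s = J s" "\<And>s. s \<in> {1..t} \<Longrightarrow> \<pi> s = \<rho> s"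
  shows "run G I \<pi> t = run G J \<rho> t"
  using assms
proof (induction t)
  case (Suc t)
  then have "run G I \<pi> t = run G J \<rho> t" "step G I \<pi> (Suc t) = step G J \<rho> (Suc t)"
    by (auto intro!: step_cong)
  then show ?case by simp
qed simp

lemma OMLA_cong: "I t = J t \<Longrightarrow> OMLA G x I t = OMLA G x J t"
  by (simp add: OMLA_def fun_eq_iff)

lemma pmf_map_filter:
  "pmf (map_pmf (\<lambda>a. case a of None \<Rightarrow> None | Some (u, l) \<Rightarrow> if P u l then Some (u, l) else None) p)
     (Some (u, l)) = (if P u l then pmf p (Some (u, l)) else 0)"
proof -
  have "(\<lambda>a. case a of None \<Rightarrow> None | Some (u, l) \<Rightarrow> if P u l then Some (u, l) else None) -` {Some (u, l)}
    = (if P u l then {Some (u, l)} else {})"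
    by (auto split: option.splits if_splits)
  then show ?thesis by (simp add: pmf_map measure_pmf_single)
qed

lemma R_value_beyond: "horizon G < t \<Longrightarrow> R_value G x u t = 0"
  by (subst R_value.simps) simp

text \<open>In increment form, using \<open>max a b - b = max 0 (a - b)\<close>, the summands are
  nonnegative for feasible \<open>x\<close>. This gives monotonicity in time and is exactly the
  expected gain of OMLA on a free machine in one step.\<close>

lemma R_value_rec:
  assumes "t \<in> times G"
  shows "R_value G x u t = R_value G x u (t + 1) + (\<Sum>e\<in>machine_edges G u. \<Sum>l\<in>levels G.
    x e l t * max 0 (Q_value G x e l t - R_value G x u (t + 1)))"
proof -
  have max: "max 0 (a - b) = max a b - b" for a b :: real by (simp add: max_def)
  show ?thesis
    using assms unfolding max right_diff_distrib
    by (subst R_value.simps)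
      (simp add: times_def sum_subtractf sum_distrib_left sum_distrib_right algebra_simps)
qed

context task_assignment
begin

lemma lp_feasible_bounds:
  assumes x: "lp_feasible G x" and "e \<in> edges G" "l \<in> levels G" "t \<in> times G"
  shows "0 \<le> x e l t" "x e l t \<le> arrival_prob G (snd e) t"
proof -
  have nonneg: "0 \<le> x e l' t" if "l' \<in> levels G" for l'
    using assms that by (auto simp: lp_feasible_def)
  then show "0 \<le> x e l t" using assms by simp
  have "x e l t \<le> (\<Sum>l\<in>levels G. x e l t)"
    by (rule member_le_sum) (use assms nonneg finite_levels in auto)
  also have "\<dots> \<le> arrival_prob G (snd e) t"
  proof -
    have "e \<in> type_edges G (snd e)" "snd e \<in> task_types G"
      using assms edge_endpoints by (auto simp: type_edges_def)
    then show ?thesis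
      using x assms(4) unfolding lp_feasible_def by blast
  qed
  finally show "x e l t \<le> arrival_prob G (snd e) t" .
qed

lemma pmf_pick:
  assumes x: "lp_feasible G x" and t: "t \<in> times G" and e: "e \<in> edges G" "l \<in> levels G"
  shows "pmf (pick G x t (snd e)) (Some (fst e, l)) = x e l t / arrival_prob G (snd e) t"
proof -
  let ?v = "snd e"
  let ?S = "{(u, l). (u, ?v) \<in> edges G \<and> l \<in> levels G}"
  let ?f = "\<lambda>(u, l). x (u, ?v) l t / arrival_prob G ?v t"
  have p: "0 \<le> arrival_prob G ?v t"
    using lp_feasible_bounds[OF x e t] by linarith
  have nonneg: "0 \<le> ?f a" if "a \<in> ?S" for a
    using that p lp_feasible_bounds(1)[OF x _ _ t] by (cases a) simp
  have "(\<Sum>a\<in>?S. ?f a)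
      = (\<Sum>e\<in>type_edges G ?v. \<Sum>l\<in>levels G. x e l t) / arrival_prob G ?v t"
    by (subst sum_type_edges) (simp add: sum_divide_distrib)
  also have "\<dots> \<le> 1"
    using x t edge_endpoints(2)[OF e(1)] p by (auto simp: lp_feasible_def divide_le_eq_1)
  finally have "pmf (sub_pmf ?S ?f) (Some (fst e, l)) = (if (fst e, l) \<in> ?S then ?f (fst e, l) else 0)"
    using nonneg pmf_sub_pmf[of ?S ?f "Some (fst e, l)", OF finite_assignments] by simp
  then show ?thesis
    unfolding pick_def using e by simp
qed

lemma R_value_mono:
  assumes "lp_feasible G x" "t \<in> times G"
  shows "R_value G x u (t + 1) \<le> R_value G x u t"
proof -
  have "0 \<le> (\<Sum>e\<in>machine_edges G u. \<Sum>l\<in>levels G.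
      x e l t * max 0 (Q_value G x e l t - R_value G x u (t + 1)))"
    using lp_feasible_bounds(1)[OF assms(1) _ _ assms(2)]
    by (intro sum_nonneg mult_nonneg_nonneg) (auto simp: machine_edges_def)
  then show ?thesis using R_value_rec[OF assms(2), of x u] by simp
qed

lemma R_value_bounded:
  obtains C where "0 \<le> C" "\<And>u t. u \<in> machines G \<Longrightarrow> \<bar>R_value G x u t\<bar> \<le> C"
proof
  let ?C = "\<Sum>(u, t)\<in>machines G \<times> {..horizon G}. \<bar>R_value G x u t\<bar>"
  show C: "0 \<le> ?C" by (auto intro: sum_nonneg)
  show "\<bar>R_value G x u t\<bar> \<le> ?C" if "u \<in> machines G" for u t
  proof (cases "t \<le> horizon G")
    case True
    then show ?thesis
      using member_le_sum[of "(u, t)" "machines G \<times> {..horizon G}" "\<lambda>(u, t). \<bar>R_value G x u t\<bar>"]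
        that finite_machines by auto
  next
    case False
    then show ?thesis using C by (simp add: R_value_beyond)
  qed
qed

text \<open>After step \<open>t\<close> a free machine can be used at \<open>t + 1\<close> at the
  earliest, hence the \<open>max\<close>. A reward is booked on acceptance, while the machine's
  remaining value is already read off at its future release time.\<close>

definition potential :: "('u, 'v) lp_var \<Rightarrow> nat \<Rightarrow> ('u, 'v) log \<Rightarrow> real" where
  "potential x t h = total_reward G h + (\<Sum>u\<in>machines G. R_value G x u (max (t + 1) (release u h)))"

lemma potential_bounded:
  obtains B where "\<And>t h. valid_log G t h \<Longrightarrow> t \<le> horizon G \<Longrightarrow> \<bar>potential x t h\<bar> \<le> B"
proof -
  obtain B where B: "0 \<le> B"
    "\<And>u v l. (u, v) \<in> edges G \<Longrightarrow> l \<in> levels G \<Longrightarrow> \<bar>reward G u v l\<bar> \<le> B"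
    by (rule reward_bounded) blast
  obtain C where C: "0 \<le> C" "\<And>u t. u \<in> machines G \<Longrightarrow> \<bar>R_value G x u t\<bar> \<le> C"
    by (rule R_value_bounded) blast
  show thesis
  proof
    fix t h assume h: "valid_log G t h" and t: "t \<le> horizon G"
    have "\<bar>total_reward G h\<bar> \<le> real t * B"
      unfolding total_reward_def
      by (rule abs_log_sum_le[OF h B(1)]) (use B in \<open>auto split: outcome.splits\<close>)
    also have "\<dots> \<le> real (horizon G) * B"
      using t B(1) by (intro mult_right_mono) auto
    moreover have "\<bar>\<Sum>u\<in>machines G. R_value G x u (max (t + 1) (release u h))\<bar>
        \<le> (\<Sum>u\<in>machines G. C)"
      by (rule order_trans[OF sum_abs]) (intro sum_mono C(2))
    ultimately show "\<bar>potential x t h\<bar> \<le> real (horizon G) * B + (\<Sum>u\<in>machines G. C)"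
      unfolding potential_def by linarith
  qed
qed

lemma potential_append:
  assumes "u \<in> machines G" "release u h \<le> s" "z \<noteq> Accepted 0"
  shows "potential x s (h @ [(s, u, v, l, z)]) = potential x s h + (case z of
      Rejected \<Rightarrow> 0
    | Accepted d \<Rightarrow> reward G u v l + R_value G x u (s + d) - R_value G x u (s + 1))"
proof -
  let ?e = "(s, u, v, l, z)"
  let ?R = "\<lambda>h u. R_value G x u (max (s + 1) (release u h))"
  have other: "?R (h @ [?e]) u' = ?R h u'" if "u' \<noteq> u" for u'
    using that by (cases z) (auto simp: release_append)
  have "(\<Sum>u\<in>machines G. ?R (h @ [?e]) u) - (\<Sum>u\<in>machines G. ?R h u) = ?R (h @ [?e]) u - ?R h u"
    using finite_machines assms(1) other by (simp add: sum.remove)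
  moreover have "?R h u = R_value G x u (s + 1)"
    using assms(2) by (simp add: max_def)
  \<comment> \<open>Here \<open>z \<noteq> Accepted 0\<close> enters: only for
    \<open>d \<ge> 1\<close> is the maximum of \<open>s + 1\<close> and \<open>s + d\<close> equal
    to \<open>s + d\<close>.\<close>
  moreover have "?R (h @ [?e]) u = (case z of Rejected \<Rightarrow> R_value G x u (s + 1)
      | Accepted d \<Rightarrow> R_value G x u (s + d))"
    using assms(2,3) by (cases z) (auto simp: release_append max_def)
  ultimately show ?thesis
    by (cases z) (simp_all add: potential_def total_reward_def)
qed

text \<open>\<open>Q_value\<close> is the value of offering the task to a free machine and
  \<open>R_value\<close> at \<open>s + 1\<close> the value of leaving it idle, so the expected gain
  of the potential is their difference.\<close>

lemma expectation_potential_assign: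
  assumes e: "e \<in> edges G" and l: "l \<in> levels G" and s: "s \<in> times G"
    and h: "release (fst e) h \<le> s"
  shows "measure_pmf.expectation (outcome_pmf G e l) (\<lambda>z. potential x s (h @ [(s, fst e, snd e, l, z)]))
    = potential x s h + (Q_value G x e l s - R_value G x (fst e) (s + 1))"
proof -
  let ?R = "R_value G x (fst e)" and ?r = "reward G (fst e) (snd e) l"
  let ?f = "\<lambda>z. potential x s h + (case z of Rejected \<Rightarrow> 0 | Accepted d \<Rightarrow> ?r + ?R (s + d) - ?R (s + 1))"
  have u: "fst e \<in> machines G" by (rule edge_endpoints[OF e])
  obtain C where C: "0 \<le> C" "\<And>u t. u \<in> machines G \<Longrightarrow> \<bar>R_value G x u t\<bar> \<le> C"
    by (rule R_value_bounded) blast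
  have f: "\<bar>?f z\<bar> \<le> \<bar>potential x s h\<bar> + \<bar>?r\<bar> + C + C" for z
  proof (cases z)
    case Rejected
    then show ?thesis using C(1) by simp
  next
    case (Accepted d)
    have "\<bar>?f z\<bar> \<le> \<bar>potential x s h\<bar> + \<bar>?r\<bar> + \<bar>?R (s + d)\<bar> + \<bar>?R (s + 1)\<bar>"
      unfolding Accepted by simp
    then show ?thesis using C(2)[OF u, of "s + d"] C(2)[OF u, of "s + 1"] by linarith
  qed
  have int: "integrable (measure_pmf (delay G l)) (\<lambda>d. ?R (s + d))"
    by (rule integrable_measure_pmf_bounded[where B = C]) (rule C(2)[OF u])
  \<comment> \<open>The finite sum in \<open>Q_value\<close> is the full expectation: delays are
    positive and \<open>R_value\<close> vanishes beyond the horizon.\<close>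
  have "measure_pmf.expectation (delay G l) (\<lambda>d. ?R (s + d))
      = (\<Sum>d\<in>{1..horizon G - s}. ?R (s + d) * pmf (delay G l) d)"
  proof (rule integral_measure_pmf_real)
    fix d assume d: "d \<in> set_pmf (delay G l)" "?R (s + d) \<noteq> 0"
    have "d \<noteq> 0" using delay_pos[OF l] d(1) by metis
    moreover have "s + d \<le> horizon G" using R_value_beyond d(2) not_le by metis
    ultimately show "d \<in> {1..horizon G - s}" by simp
  qed simp
  then have Q: "Q_value G x e l s = accept_prob G e *
      (?r + measure_pmf.expectation (delay G l) (\<lambda>d. ?R (s + d))) + (1 - accept_prob G e) * ?R (s + 1)"
    by (cases e) (simp add: Q_value.simps mult.commute)
  have "measure_pmf.expectation (outcome_pmf G e l) (\<lambda>z. potential x s (h @ [(s, fst e, snd e, l, z)]))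
      = measure_pmf.expectation (outcome_pmf G e l) ?f"
    by (rule integral_cong_pmf, rule potential_append[OF u h])
      (use outcome_not_Accepted_0[OF l] in metis)
  also have "\<dots> = accept_prob G e * measure_pmf.expectation (delay G l) (\<lambda>d. ?f (Accepted d))
      + (1 - accept_prob G e) * ?f Rejected"
    by (rule expectation_outcome[OF e f])
  also have "\<dots> = potential x s h + (Q_value G x e l s - ?R (s + 1))"
    unfolding Q using int by (simp add: algebra_simps)
  finally show ?thesis .
qed

section \<open>The choices of OMLA and the one-step martingale identity\<close>

lemma sum_machine_edges:
  fixes g :: "'u \<times> 'v \<Rightarrow> real"
  shows "(\<Sum>u\<in>machines G. \<Sum>e\<in>machine_edges G u. g e) = (\<Sum>e\<in>edges G. g e)"
  unfolding machine_edges_def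
  by (rule sum.group) (use finite_edges finite_machines edge_endpoints in auto)

lemma admissible_OMLA: "lp_feasible G x \<Longrightarrow> admissible G I (OMLA G x I)"
  using OMLA_online_algorithm[OF valid] by (simp add: online_algorithm_def)

lemma choice_prob_OMLA:
  assumes x: "lp_feasible G x" and budget: "\<forall>u \<in> machines G. budget G u = \<infinity>"
    and "s \<in> times G" "e \<in> edges G" "l \<in> levels G"
  shows "choice_prob I (OMLA G x I) s h e l = (if I s = Some (snd e) then
      (if release (fst e) h \<le> s \<and> R_value G x (fst e) (s + 1) \<le> Q_value G x e l s
       then x e l s / arrival_prob G (snd e) s else 0) else 0)"
  using assms(2-) edge_endpoints[of e]
  by (auto simp: choice_prob_def OMLA_def pmf_map_filter pmf_pick[OF x] available_observe_iff)

text \<open>The passage of one idle step lowers the term of a free machine from its value at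
  \<open>t + 1\<close> to that at \<open>t + 2\<close>; by the recursion the expected gain of OMLA
  restores exactly this amount. The constant sequence stands in for the arrivals because a step of
  OMLA reads only the current one.\<close>

lemma expectation_potential_step:
  assumes x: "lp_feasible G x" and budget: "\<forall>u \<in> machines G. budget G u = \<infinity>"
    and s: "Suc t \<in> times G" and h: "valid_log G t h"
  shows "measure_pmf.expectation (arrival_at (Suc t)) (\<lambda>z. measure_pmf.expectation
      (step G (\<lambda>_. z) (OMLA G x (\<lambda>_. z)) (Suc t) h) (potential x (Suc t))) = potential x t h"
proof -
  let ?s = "Suc t"
  let ?R = "R_value G x" and ?Q = "\<lambda>e l. Q_value G x e l ?s"
  define a where "a e l = (if release (fst e) h \<le> ?s \<and> ?R (fst e) (?s + 1) \<le> ?Q e l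
       then x e l ?s / arrival_prob G (snd e) ?s else 0)" for e l
  define g where "g e l = ?Q e l - ?R (fst e) (?s + 1)" for e l
  obtain B where B: "\<And>t h. valid_log G t h \<Longrightarrow> t \<le> horizon G \<Longrightarrow> \<bar>potential x t h\<bar> \<le> B"
    by (rule potential_bounded) blast
  have step: "measure_pmf.expectation (step G (\<lambda>_. z) (OMLA G x (\<lambda>_. z)) ?s h) (potential x ?s)
      = potential x ?s h + (\<Sum>e\<in>edges G. \<Sum>l\<in>levels G. (if z = Some (snd e) then a e l else 0) * g e l)" for z
  proof -
    have "\<bar>potential x ?s h'\<bar> \<le> B" if "h' \<in> set_pmf (step G (\<lambda>_. z) (OMLA G x (\<lambda>_. z)) ?s h)" for h'
      using B[OF valid_log_step[OF admissible_OMLA[OF x] s h that]] s by (simp add: times_def)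
    then have "measure_pmf.expectation (step G (\<lambda>_. z) (OMLA G x (\<lambda>_. z)) ?s h) (potential x ?s)
      = potential x ?s h + (\<Sum>e\<in>edges G. \<Sum>l\<in>levels G. choice_prob (\<lambda>_. z) (OMLA G x (\<lambda>_. z)) ?s h e l *
        (measure_pmf.expectation (outcome_pmf G e l) (\<lambda>z. potential x ?s (h @ [(?s, fst e, snd e, l, z)]))
          - potential x ?s h))"
      by (rule expectation_step[OF admissible_OMLA[OF x] s])
    also have "\<dots> = potential x ?s h +
        (\<Sum>e\<in>edges G. \<Sum>l\<in>levels G. (if z = Some (snd e) then a e l else 0) * g e l)"
    proof (intro arg_cong2[where f = "(+)"] sum.cong refl)
      fix e l assume e: "e \<in> edges G" and l: "l \<in> levels G"
      show "choice_prob (\<lambda>_. z) (OMLA G x (\<lambda>_. z)) ?s h e l *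
        (measure_pmf.expectation (outcome_pmf G e l) (\<lambda>z. potential x ?s (h @ [(?s, fst e, snd e, l, z)]))
          - potential x ?s h) = (if z = Some (snd e) then a e l else 0) * g e l"
      proof (cases "release (fst e) h \<le> ?s")
        case True
        show ?thesis
          unfolding choice_prob_OMLA[OF x budget s e l] expectation_potential_assign[OF e l s True]
          by (simp add: a_def g_def)
      next
        case False
        then show ?thesis
          unfolding choice_prob_OMLA[OF x budget s e l] by (simp add: a_def)
      qed
    qed
    finally show ?thesis .
  qed
  \<comment> \<open>Multiplying by the arrival probability cancels the quotient in the pick
    probability. If the arrival probability is 0, feasibility forces \<open>x e l ?s = 0\<close>, so
    the identity persists.\<close>
  have mean: "a e l * arrival_prob G (snd e) ?s * g e l
      = (if release (fst e) h \<le> ?s then x e l ?s * max 0 (g e l) else 0)"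
    if "e \<in> edges G" "l \<in> levels G" for e l
    using lp_feasible_bounds[OF x that s] by (auto simp: a_def g_def max_def)
  have "measure_pmf.expectation (arrival_at ?s) (\<lambda>z. measure_pmf.expectation
      (step G (\<lambda>_. z) (OMLA G x (\<lambda>_. z)) ?s h) (potential x ?s))
    = potential x ?s h + (\<Sum>e\<in>edges G. \<Sum>l\<in>levels G. measure_pmf.expectation (arrival_at ?s)
        (\<lambda>z. if z = Some (snd e) then a e l else 0) * g e l)"
    unfolding step by (simp add: integrable_measure_pmf_finite[OF finite_set_arrival_at[OF s]])
  also have "\<dots> = potential x ?s h + (\<Sum>e\<in>edges G. \<Sum>l\<in>levels G.
      if release (fst e) h \<le> ?s then x e l ?s * max 0 (g e l) else 0)"
    by (intro arg_cong2[where f = "(+)"] sum.cong refl)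
      (simp only: expectation_arrival_at[OF s edge_endpoints(2)] mean)
  also have "\<dots> = total_reward G h + (\<Sum>u\<in>machines G. ?R u (max (?s + 1) (release u h))
      + (\<Sum>e\<in>machine_edges G u. \<Sum>l\<in>levels G.
          if release u h \<le> ?s then x e l ?s * max 0 (?Q e l - ?R u (?s + 1)) else 0))"
    unfolding potential_def sum_machine_edges[symmetric] sum.distrib
    by (auto simp: g_def machine_edges_def intro!: sum.cong)
  also have "\<dots> = potential x t h"
    unfolding potential_def
  proof (intro arg_cong2[where f = "(+)"] sum.cong refl)
    fix u
    show "?R u (max (?s + 1) (release u h)) + (\<Sum>e\<in>machine_edges G u. \<Sum>l\<in>levels G.
        if release u h \<le> ?s then x e l ?s * max 0 (?Q e l - ?R u (?s + 1)) else 0)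
      = ?R u (max (t + 1) (release u h))"
    proof (cases "release u h \<le> ?s")
      case True
      then show ?thesis using R_value_rec[OF s, of x u] by (simp add: max_def)
    next
      case False
      then show ?thesis by (simp add: max_def)
    qed
  qed
  finally show ?thesis .
qed

text \<open>Only the first \<open>t\<close> arrivals are drawn, so the next arrival is independent
  of the log and the one-step identity can be averaged. At the horizon this is the full arrival
  sequence followed by the run of OMLA.\<close>

definition online_run :: "('u, 'v) lp_var \<Rightarrow> nat \<Rightarrow> ('u, 'v) log pmf" where
  "online_run x t = bind_pmf (Pi_pmf {1..t} None arrival_at) (\<lambda>I. run G I (OMLA G x I) t)"

text \<open>This is where OMLA being online matters: changing the arrival at \<open>Suc t\<close>
  does not affect the run up to \<open>t\<close>. That arrival may therefore be drawn after the run
  instead of before it.\<close>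

lemma online_run_Suc:
  "online_run x (Suc t) = bind_pmf (online_run x t) (\<lambda>h. bind_pmf (arrival_at (Suc t))
     (\<lambda>z. step G (\<lambda>_. z) (OMLA G x (\<lambda>_. z)) (Suc t) h))"
proof -
  have run: "run G (I(Suc t := z)) (OMLA G x (I(Suc t := z))) (Suc t)
      = bind_pmf (run G I (OMLA G x I) t) (step G (\<lambda>_. z) (OMLA G x (\<lambda>_. z)) (Suc t))" for I z
  proof -
    have "run G (I(Suc t := z)) (OMLA G x (I(Suc t := z))) t = run G I (OMLA G x I) t"
      by (intro run_cong OMLA_cong) auto
    moreover have "step G (I(Suc t := z)) (OMLA G x (I(Suc t := z))) (Suc t)
        = step G (\<lambda>_. z) (OMLA G x (\<lambda>_. z)) (Suc t)"
      by (intro ext step_cong OMLA_cong) auto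
    ultimately show ?thesis by simp
  qed
  have "{1..Suc t} = insert (Suc t) {1..t}" by auto
  then have "online_run x (Suc t) = bind_pmf (arrival_at (Suc t)) (\<lambda>z.
      bind_pmf (Pi_pmf {1..t} None arrival_at) (\<lambda>I. run G (I(Suc t := z)) (OMLA G x (I(Suc t := z))) (Suc t)))"
    unfolding online_run_def
    by (simp add: Pi_pmf_insert' bind_assoc_pmf bind_return_pmf del: run.simps)
  also have "\<dots> = bind_pmf (Pi_pmf {1..t} None arrival_at) (\<lambda>I. bind_pmf (run G I (OMLA G x I) t)
      (\<lambda>h. bind_pmf (arrival_at (Suc t)) (\<lambda>z. step G (\<lambda>_. z) (OMLA G x (\<lambda>_. z)) (Suc t) h)))"
    unfolding run by (subst bind_commute_pmf) (intro bind_pmf_cong refl, rule bind_commute_pmf)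
  finally show ?thesis
    by (simp add: online_run_def bind_assoc_pmf)
qed

lemma valid_log_online_run:
  assumes "lp_feasible G x" "t \<le> horizon G" "h \<in> set_pmf (online_run x t)"
  shows "valid_log G t h"
  using assms valid_log_run[OF admissible_OMLA] by (auto simp: online_run_def)

lemma expectation_potential_online_run:
  assumes x: "lp_feasible G x" and budget: "\<forall>u \<in> machines G. budget G u = \<infinity>"
  shows "t \<le> horizon G \<Longrightarrow>
    measure_pmf.expectation (online_run x t) (potential x t) = (\<Sum>u\<in>machines G. R_value G x u 1)"
proof (induction t)
  case 0
  then show ?case by (simp add: online_run_def potential_def total_reward_def)
next
  case (Suc t)
  have s: "Suc t \<in> times G" using Suc.prems by (simp add: times_def)
  obtain B where B: "\<And>t h. valid_log G t h \<Longrightarrow> t \<le> horizon G \<Longrightarrow> \<bar>potential x t h\<bar> \<le> B"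
    by (rule potential_bounded) blast
  let ?k = "\<lambda>h z. step G (\<lambda>_. z) (OMLA G x (\<lambda>_. z)) (Suc t) h"
  have bound: "\<bar>potential x (Suc t) h\<bar> \<le> B"
    if "h \<in> set_pmf (bind_pmf (online_run x t) (\<lambda>h. bind_pmf (arrival_at (Suc t)) (?k h)))" for h
    using B[OF valid_log_online_run[OF x Suc.prems, unfolded online_run_Suc, OF that] Suc.prems] .
  have "measure_pmf.expectation (online_run x (Suc t)) (potential x (Suc t))
      = measure_pmf.expectation (online_run x t) (\<lambda>h. measure_pmf.expectation
          (bind_pmf (arrival_at (Suc t)) (?k h)) (potential x (Suc t)))"
    unfolding online_run_Suc by (rule integral_bind_pmf_bounded[OF bound])
  also have "\<dots> = measure_pmf.expectation (online_run x t) (potential x t)"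
  proof (rule integral_cong_pmf)
    fix h assume h: "h \<in> set_pmf (online_run x t)"
    have "measure_pmf.expectation (bind_pmf (arrival_at (Suc t)) (?k h)) (potential x (Suc t))
        = measure_pmf.expectation (arrival_at (Suc t))
            (\<lambda>z. measure_pmf.expectation (?k h z) (potential x (Suc t)))"
      by (rule integral_bind_pmf_bounded[where B = B], rule bound) (use h in auto)
    also have "\<dots> = potential x t h"
      by (rule expectation_potential_step[OF x budget s])
        (use valid_log_online_run[OF x _ h] Suc.prems in simp)
    finally show "measure_pmf.expectation (bind_pmf (arrival_at (Suc t)) (?k h)) (potential x (Suc t))
        = potential x t h" .
  qed
  finally show ?case using Suc by simp
qed

lemma expectation_OMLA:
  assumes x: "lp_feasible G x" and budget: "\<forall>u \<in> machines G. budget G u = \<infinity>"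
  shows "measure_pmf.expectation (arrivals G) (\<lambda>I. policy_value G I (OMLA G x I))
    = (\<Sum>u\<in>machines G. R_value G x u 1)"
proof -
  let ?T = "horizon G"
  obtain B where B: "\<And>t h. valid_log G t h \<Longrightarrow> t \<le> ?T \<Longrightarrow> \<bar>potential x t h\<bar> \<le> B"
    by (rule potential_bounded) blast
  \<comment> \<open>All values-to-go are evaluated at \<open>?T + 1\<close> or later, where they
    vanish.\<close>
  have total: "potential x ?T = total_reward G"
    by (simp add: fun_eq_iff potential_def R_value_beyond)
  have run: "online_run x ?T = bind_pmf (arrivals G) (\<lambda>I. run G I (OMLA G x I) ?T)"
    by (simp add: online_run_def arrivals_def times_def)
  have "measure_pmf.expectation (online_run x ?T) (total_reward G)
      = measure_pmf.expectation (arrivals G) (\<lambda>I. policy_value G I (OMLA G x I))"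
    unfolding policy_value_def run
    by (rule integral_bind_pmf_bounded[where B = B], fold run total)
      (rule B[OF valid_log_online_run[OF x]], simp_all)
  then show ?thesis
    using expectation_potential_online_run[OF x budget order_refl] by (simp add: total)
qed

section \<open>Comparison with the linear program\<close>

text \<open>Instantiates the abstract comparison with the mass
  \<open>accept_prob G e * x e l t\<close>: rejected tasks do not occupy the machine, so acceptance
  can be absorbed into the weights.\<close>

lemma R_value_lower_bound:
  assumes x: "lp_feasible G x" and u: "u \<in> machines G"
  shows "(\<Sum>t\<in>times G. \<Sum>e\<in>machine_edges G u. \<Sum>l\<in>levels G.
      accept_prob G e * x e l t * reward G (fst e) (snd e) l) \<le> 2 * R_value G x u 1"
proof -
  let ?K = "machine_edges G u \<times> levels G"
  let ?R = "R_value G x u"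
  define y where "y = (\<lambda>(e, l) t. accept_prob G e * x e l t)"
  define D where "D = (\<lambda>(e :: 'u \<times> 'v, l). delay G l)"
  define r where "r = (\<lambda>(e, l). reward G (fst e) (snd e) l)"
  have K: "e \<in> edges G" "fst e = u" "l \<in> levels G" if "(e, l) \<in> ?K" for e l
    using that by (auto simp: machine_edges_def)
  have "(\<Sum>t\<in>{1..horizon G}. \<Sum>k\<in>?K. y k t * r k) \<le> 2 * ?R 1"
  proof (rule value_to_go_lower_bound[where R = ?R and y = y and D = D and r = r])
    show "0 \<notin> set_pmf (D k)" if "k \<in> ?K" for k
      using that delay_pos by (auto simp: D_def)
    show "0 \<le> y k t" if "k \<in> ?K" "t \<in> {1..horizon G}" for k t
      using that K lp_feasible_bounds(1)[OF x] accept_prob_bounds(1)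
      by (auto simp: y_def times_def)
    show "?R (horizon G + 1) = 0" by (simp add: R_value_beyond)
    show "?R (t + 1) \<le> ?R t" if "t \<in> {1..horizon G}" for t
      using R_value_mono[OF x] that by (simp add: times_def)
    show "(\<Sum>k\<in>?K. y k t * (r k + (\<Sum>d\<in>{1..horizon G - t}. pmf (D k) d * ?R (t + d)) - ?R (t + 1)))
        \<le> ?R t - ?R (t + 1)" if "t \<in> {1..horizon G}" for t
    proof -
      have t: "t \<in> times G" using that by (simp add: times_def)
      have "(\<Sum>k\<in>?K. y k t * (r k + (\<Sum>d\<in>{1..horizon G - t}. pmf (D k) d * ?R (t + d)) - ?R (t + 1)))
          \<le> (\<Sum>(e, l)\<in>?K. x e l t * max 0 (Q_value G x e l t - ?R (t + 1)))"
      proof (rule sum_mono, clarify)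
        fix a b l assume "(a, b) \<in> machine_edges G u" "l \<in> levels G"
        then have k: "((a, b), l) \<in> ?K" by simp
        \<comment> \<open>On rejection the machine keeps the value \<open>?R (t + 1)\<close>, so
          this part cancels in \<open>Q_value - ?R (t + 1)\<close> and the factor
          \<open>accept_prob\<close> remains.\<close>
        have "y ((a, b), l) t * (r ((a, b), l)
              + (\<Sum>d\<in>{1..horizon G - t}. pmf (D ((a, b), l)) d * ?R (t + d)) - ?R (t + 1))
            = x (a, b) l t * (Q_value G x (a, b) l t - ?R (t + 1))"
          using K(2)[OF k] by (simp add: y_def r_def D_def Q_value.simps algebra_simps)
        \<comment> \<open>The option of skipping a picked pair can only raise the value, so only
          \<open>max 0 a \<ge> a\<close> is used.\<close>
        also have "\<dots> \<le> x (a, b) l t * max 0 (Q_value G x (a, b) l t - ?R (t + 1))"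
          using lp_feasible_bounds(1)[OF x K(1,3)[OF k] t] by (intro mult_left_mono) auto
        finally show "y ((a, b), l) t * (r ((a, b), l)
              + (\<Sum>d\<in>{1..horizon G - t}. pmf (D ((a, b), l)) d * ?R (t + d)) - ?R (t + 1))
            \<le> x (a, b) l t * max 0 (Q_value G x (a, b) l t - ?R (t + 1))" .
      qed
      also have "\<dots> = ?R t - ?R (t + 1)"
        using R_value_rec[OF t, of x u] by (simp add: sum.cartesian_product)
      finally show ?thesis .
    qed
    show "(\<Sum>t\<in>{1..<s}. \<Sum>k\<in>?K. y k t * measure_pmf.prob (D k) {s - t + 1..}) + (\<Sum>k\<in>?K. y k s) \<le> 1"
      if "s \<in> {1..horizon G}" for s
    proof -
      have "(\<Sum>t'\<in>{1..<s}. \<Sum>e\<in>machine_edges G u. accept_prob G e *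
           (\<Sum>l\<in>levels G. x e l t' * measure_pmf.prob (delay G l) {s - t' + 1..}))
        + (\<Sum>e\<in>machine_edges G u. accept_prob G e * (\<Sum>l\<in>levels G. x e l s)) \<le> 1"
        using x u that by (simp add: lp_feasible_def times_def)
      then show ?thesis
        by (simp add: y_def D_def sum.cartesian_product case_prod_unfold sum_distrib_left mult.assoc)
    qed
  qed
  then show ?thesis
    by (simp add: y_def r_def times_def case_prod_unfold sum.cartesian_product)
qed

lemma lp_objective_le:
  assumes x: "lp_feasible G x"
  shows "lp_objective G x \<le> 2 * (\<Sum>u\<in>machines G. R_value G x u 1)"
proof -
  have "lp_objective G x = (\<Sum>t\<in>times G. \<Sum>u\<in>machines G. \<Sum>e\<in>machine_edges G u. \<Sum>l\<in>levels G.
      accept_prob G e * x e l t * reward G (fst e) (snd e) l)"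
    by (simp add: lp_objective_def sum_machine_edges case_prod_unfold sum_distrib_left mult_ac)
  also have "\<dots> = (\<Sum>u\<in>machines G. \<Sum>t\<in>times G. \<Sum>e\<in>machine_edges G u. \<Sum>l\<in>levels G.
      accept_prob G e * x e l t * reward G (fst e) (snd e) l)"
    by (rule sum.swap)
  also have "\<dots> \<le> (\<Sum>u\<in>machines G. 2 * R_value G x u 1)"
    by (intro sum_mono R_value_lower_bound x)
  finally show ?thesis by (simp add: sum_distrib_left)
qed

end

theorem theorem1:
  fixes G :: "('u, 'v) task_instance" and x :: "('u, 'v) lp_var"
  assumes "valid_instance G"
    and "\<forall>u \<in> machines G. budget G u = \<infinity>"
    and "lp_optimal G x"
  shows "measure_pmf.expectation (arrivals G) (\<lambda>I. policy_value G I (OMLA G x I))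
           \<ge> 1 / 2 * measure_pmf.expectation (arrivals G) (OPT G)"
proof -
  interpret task_assignment G
    by unfold_locales (rule assms(1))
  have "lp_feasible G x"
    using assms(3) by (simp add: lp_optimal_def)
  then show ?thesis
    using expectation_OPT_le_lp[OF assms(2,3)] lp_objective_le[of x] expectation_OMLA[of x] assms(2)
    by simp
qed

end
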